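(* Let $s\in(0,1)$, $n>\max\left\{4s,\frac{8s+2}{3}\right\}$, $p=\frac{n+2s}{n-2s}$, let $\Omega\subset\mathbb{R}^n$ be a bounded domain of class $C^1$, and let $\lambda^*=\frac{S}{(2|\Omega|)^{2s/n}}$. Let $\lambda>\lambda^*$. Then there exists $\delta>0$ such that for every $0<\eta<\delta$, $X_\lambda(\Omega_\eta)$ has a unique minimizer up to multiplication by nonzero constants; that is, there is a function $v\in H^s_{\Omega_\eta}\setminus\{0\}$ attaining the infimum defining $X_\lambda(\Omega_\eta)$, and any other such function is a nonzero constant multiple of $v$.
   Context: $|\Omega|$ denotes Lebesgue measure, and $\Omega_\eta=\{\eta x:x\in\Omega\}$ for $\eta>0$. $c_{n,s}=\left(\int_{\mathbb{R}^n}\frac{1-\cos(\theta_1)}{|\theta|^{n+2s}}\,d\theta\right)^{-1}$, where $\theta_1$ is the first coordinate of $\theta$. For a bounded domain $D\subset\mathbb{R}^n$ let $T(D)=\mathbb{R}^{2n}\setminus(\mathbb{R}^n\setminus D)^2$, and let $H^s_D$ be the space of measurable functions $u:\mathbb{R}^n\to\mathbb{R}$ with $\|u\|_{L^2(D)}^2+\int_{T(D)}\frac{|u(x)-u(y)|^2}{|x-y|^{n+2s}}\,dx\,dy<\infty$ (functions equal a.e. are identified). Define $$X_\lambda(D)=\inf_{u\in H^s_D\setminus\{0\}}\frac{\frac{c_{n,s}}{2}\int_{T(D)}\frac{|u(x)-u(y)|^2}{|x-y|^{n+2s}}\,dx\,dy+\lambda\int_D u^2\,dx}{\left(\int_D|u|^{p+1}\,dx\right)^{\frac{2}{p+1}}}.$$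 $S$ is the best constant in the fractional Sobolev inequality $S\left(\int_{\mathbb{R}^n}|u|^{p+1}\,dx\right)^{\frac{2}{p+1}}\le\frac{c_{n,s}}{2}\int_{\mathbb{R}^n}\int_{\mathbb{R}^n}\frac{|u(x)-u(y)|^2}{|x-y|^{n+2s}}\,dx\,dy$ for all $u\in H^s(\mathbb{R}^n)$; explicitly $S=2^{2s}\pi^s\frac{\Gamma(\frac{n+2s}{2})}{\Gamma(\frac{n-2s}{2})}\left[\frac{\Gamma(\frac n2)}{\Gamma(n)}\right]^{\frac{2s}{n}}$. *)

theory Defs
  imports "HOL-Analysis.Analysis"
begin

section \<open>Domains of class C1\<close>

definition C1_function :: "('a::euclidean_space \<Rightarrow> real) \<Rightarrow> bool" where
  "C1_function g \<longleftrightarrow>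
     (\<exists>G. continuous_on UNIV G \<and> (\<forall>x. (g has_derivative (\<lambda>h. G x \<bullet> h)) (at x)))"

text \<open>
  Near every boundary point the set is the strict supergraph of a C1 function, after a rotation of
  the axes. The unit vector \<open>\<nu>\<close> is the rotated last axis, and \<open>x - (x \<bullet> \<nu>) *\<^sub>R \<nu>\<close> is the orthogonal
  projection of \<open>x\<close> onto the hyperplane of the remaining coordinates, so only the values of \<open>g\<close> on
  that hyperplane matter. (A C1 function on the hyperplane extends to the whole space by
  composition with the projection.)
\<close>

definition C1_boundary :: "'a::euclidean_space set \<Rightarrow> bool" where
  "C1_boundary \<Omega> \<longleftrightarrow>
     (\<forall>x0\<in>frontier \<Omega>. \<exists>\<nu> r g. norm \<nu> = 1 \<and> r > 0 \<and> C1_function g \<and>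
        \<Omega> \<inter> ball x0 r = {x \<in> ball x0 r. g (x - (x \<bullet> \<nu>) *\<^sub>R \<nu>) < x \<bullet> \<nu>})"

definition bounded_C1_domain :: "'a::euclidean_space set \<Rightarrow> bool" where
  "bounded_C1_domain \<Omega> \<longleftrightarrow>
     \<Omega> \<noteq> {} \<and> open \<Omega> \<and> connected \<Omega> \<and> bounded \<Omega> \<and> C1_boundary \<Omega>"


section \<open>The fractional energy\<close>

text \<open>
  The coordinates are indexed by a finite well-ordered type, so that there is a first one,
  \<open>Min UNIV\<close>.
\<close>

definition frac_const :: "'n::{finite,wellorder} itself \<Rightarrow> real \<Rightarrow> real" where
  "frac_const _ s =
     inverse (LINT \<theta>|(lebesgue :: (real^'n::_) measure).
       (1 - cos (\<theta> $ Min UNIV)) / norm \<theta> powr (real CARD('n) + 2 * s))"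

definition cross_set :: "'a set \<Rightarrow> ('a \<times> 'a) set" where
  "cross_set D = UNIV - (- D) \<times> (- D)"

text \<open>On the diagonal, a null set, the kernel takes the junk value 0.\<close>

definition gagliardo_kernel ::
  "real \<Rightarrow> (real^'n::{finite,wellorder} \<Rightarrow> real) \<Rightarrow> (real^'n::_) \<times> (real^'n::_) \<Rightarrow> real" where
  "gagliardo_kernel s u =
     (\<lambda>(x, y). \<bar>u x - u y\<bar>\<^sup>2 / norm (x - y) powr (real CARD('n) + 2 * s))"

text \<open>
  Elements are functions on the whole space, not classes modulo null sets. With \<open>D = UNIV\<close> this is
  the usual space \<open>H\<^sup>s\<close> on the whole space, since \<open>cross_set UNIV = UNIV\<close>.
\<close>

definition frac_space :: "real \<Rightarrow> (real^'n::{finite,wellorder}) set \<Rightarrow> (real^'n::_ \<Rightarrow> real) set" where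
  "frac_space s D =
     {u. u \<in> borel_measurable lebesgue \<and>
         set_integrable lebesgue D (\<lambda>x. (u x)\<^sup>2) \<and>
         set_integrable lebesgue (cross_set D) (gagliardo_kernel s u)}"

definition frac_energy :: "real \<Rightarrow> (real^'n::{finite,wellorder}) set \<Rightarrow> (real^'n::_ \<Rightarrow> real) \<Rightarrow> real" where
  "frac_energy s D u =
     frac_const TYPE('n) s / 2 * set_lebesgue_integral lebesgue (cross_set D) (gagliardo_kernel s u)"

text \<open>\<open>(\<integral>\<^sub>D \<bar>u\<bar>\<^sup>q)\<close> raised to the power \<open>2 / q\<close>, infinite if the integral is.\<close>

definition Lq_norm_sq :: "real \<Rightarrow> 'a::euclidean_space set \<Rightarrow> ('a \<Rightarrow> real) \<Rightarrow> ereal" where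
  "Lq_norm_sq q D u =
     (let I = (\<integral>\<^sup>+x\<in>D. ennreal (\<bar>u x\<bar> powr q) \<partial>lebesgue)
      in if I = \<infinity> then \<infinity> else ereal (enn2real I powr (2 / q)))"


section \<open>The Sobolev constant and the minimization problem\<close>

definition crit_exp :: "'n::{finite,wellorder} itself \<Rightarrow> real \<Rightarrow> real" where
  "crit_exp _ s = (real CARD('n) + 2 * s) / (real CARD('n) - 2 * s)"

text \<open>The largest constant for which the fractional Sobolev inequality holds.\<close>

definition sobolev_const :: "'n::{finite,wellorder} itself \<Rightarrow> real \<Rightarrow> real" where
  "sobolev_const _ s =
     Sup {C. \<forall>u \<in> frac_space s (UNIV :: (real^'n::_) set).
              ereal C * Lq_norm_sq (crit_exp TYPE('n) s + 1) UNIV u \<le> ereal (frac_energy s UNIV u)}"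

definition frac_space_nonzero ::
  "real \<Rightarrow> (real^'n::{finite,wellorder}) set \<Rightarrow> (real^'n::_ \<Rightarrow> real) set" where
  "frac_space_nonzero s D = {u \<in> frac_space s D. \<not> (AE x in lebesgue. u x = 0)}"

text \<open>
  A nonzero \<open>u\<close> may vanish almost everywhere on \<open>D\<close>. For \<open>lam > 0\<close> and \<open>D\<close> of positive measure its
  numerator is still positive, and the quotient is then \<open>\<infinity>\<close> in \<^typ>\<open>ereal\<close>, so such
  functions do not affect the infimum.
\<close>

definition rayleigh ::
  "real \<Rightarrow> real \<Rightarrow> (real^'n::{finite,wellorder}) set \<Rightarrow> (real^'n::_ \<Rightarrow> real) \<Rightarrow> ereal" where
  "rayleigh s lam D u =
     ereal (frac_energy s D u + lam * set_lebesgue_integral lebesgue D (\<lambda>x. (u x)\<^sup>2))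
       / Lq_norm_sq (crit_exp TYPE('n) s + 1) D u"

definition X_inf :: "real \<Rightarrow> real \<Rightarrow> (real^'n::{finite,wellorder}) set \<Rightarrow> ereal" where
  "X_inf s lam D = (INF u \<in> frac_space_nonzero s D. rayleigh s lam D u)"

definition is_minimizer ::
  "real \<Rightarrow> real \<Rightarrow> (real^'n::{finite,wellorder}) set \<Rightarrow> (real^'n::_ \<Rightarrow> real) \<Rightarrow> bool" where
  "is_minimizer s lam D v \<longleftrightarrow> v \<in> frac_space_nonzero s D \<and> rayleigh s lam D v = X_inf s lam D"

definition lambda_star :: "real \<Rightarrow> (real^'n::{finite,wellorder}) set \<Rightarrow> real" where
  "lambda_star s \<Omega> =
     sobolev_const TYPE('n) s / (2 * measure lebesgue \<Omega>) powr (2 * s / real CARD('n))"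

end

theory Submission
  imports Defs
begin

text \<open>
  The minimizers on small domains are the nonzero constants. Put \<open>q = p + 1\<close> and \<open>V = |D|\<close>.
  Expand \<open>|m + h|\<^sup>q\<close> to second order around the mean \<open>m\<close> of \<open>u = m + h\<close> over \<open>D\<close>; the linear term
  integrates to 0, and a fractional Sobolev-Poincare inequality bounds \<open>h\<close> by the Gagliardo
  seminorm \<open>[u]\<close> on \<open>D \<times> D\<close>. This gives
  \<open>\<parallel>u\<parallel>\<^sub>q\<^sup>2 \<le> \<theta>\<^sup>-\<^sup>1 \<parallel>u\<parallel>\<^sub>2\<^sup>2 + K [u]\<^sup>2\<close> with \<open>\<theta> = V\<close> to the power \<open>2s/n\<close>. As the exponent is critical,
  \<open>K\<close> is the same for all dilates of \<open>D\<close>, so on small domains \<open>\<lambda> \<theta> K < c\<^bsub>n,s\<^esub> / 2\<close>. Then the quotient is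
  at least \<open>\<lambda> \<theta>\<close>, with equality only if the energy vanishes.

  The Sobolev-Poincare inequality needs only that balls centred in \<open>D\<close> meet \<open>D\<close> in a fixed
  proportion of their volume, which a \<open>C\<^sup>1\<close> boundary guarantees through an interior cone condition.
\<close>

section \<open>The corkscrew condition\<close>

text \<open>The coefficient \<theta>^-1 of the L2 term must be exact: constants attain it, and any
  larger factor would push the lower bound below the value of the quotient at constants. The
  triangle inequality for u = m + h leaves a cross term of first order in h, which a multiple of
  [u]^2 controls only if that coefficient grows; the mean-zero property of h removes it. Jensen's
  inequality, sharp for constants, passes from m^2 to the L2 norm.

  K is common to all dilates because the domain enters it through the density ratio \<kappa>, which
  a dilation preserves; the length scale \<rho> cancels against V \<ge> \<kappa> \<rho>^n.
  Uniqueness holds on the whole space because the energy counts all pairs in D times the whole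
  space, so a function of zero energy is constant outside D as well.

  Two obstacles shape the details: the critical norm is not known to be finite beforehand, which
  leads to truncation, and the competitors are Lebesgue measurable, whereas Tonelli's theorem is
  applied to Borel representatives.\<close>

lemma C1_function_lipschitz_cball:
  assumes "C1_function (g :: 'a::euclidean_space \<Rightarrow> real)"
  obtains L where "L \<ge> 0"
    "\<And>x y. x \<in> cball c R \<Longrightarrow> y \<in> cball c R \<Longrightarrow> \<bar>g x - g y\<bar> \<le> L * norm (x - y)"
proof -
  obtain G where G: "continuous_on UNIV G" "\<And>x. (g has_derivative (\<lambda>h. G x \<bullet> h)) (at x)"
    using assms unfolding C1_function_def by blast
  have "bounded (G ` cball c R)"
    by (intro compact_imp_bounded compact_continuous_image continuous_on_subset[OF G(1)]) auto
  then obtain L where L: "L > 0" "\<And>x. x \<in> cball c R \<Longrightarrow> norm (G x) \<le> L"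
    unfolding bounded_pos by auto
  show thesis
  proof (rule that[of L])
    fix x y assume "x \<in> cball c R" "y \<in> cball c R"
    moreover have "onorm (\<lambda>h. G z \<bullet> h) \<le> L" if "z \<in> cball c R" for z
    proof (rule onorm_le)
      fix h
      have "norm (G z \<bullet> h) \<le> norm (G z) * norm h" by (simp add: Cauchy_Schwarz_ineq2)
      also have "\<dots> \<le> L * norm h" using L(2)[OF that] by (simp add: mult_right_mono)
      finally show "norm (G z \<bullet> h) \<le> L * norm h" .
    qed
    ultimately have "norm (g x - g y) \<le> L * norm (x - y)"
      using G(2) by (intro differentiable_bound[of "cball c R" g "\<lambda>z h. G z \<bullet> h"])
        (auto intro: has_derivative_at_withinI)
    then show "\<bar>g x - g y\<bar> \<le> L * norm (x - y)" by simp
  qed (use L in simp)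
qed

text \<open>The cone condition in a form suited to dilations: \<open>a\<close> is a ratio of radii,
  so scaling D changes only the range \<open>\<rho>\<close>. The centre x runs over D itself, not
  over its boundary, since the averages below are taken around points of D.\<close>

definition corkscrew :: "real \<Rightarrow> real \<Rightarrow> 'a::euclidean_space set \<Rightarrow> bool" where
  "corkscrew a \<rho> D \<longleftrightarrow> (\<forall>x\<in>D. \<forall>t. 0 < t \<and> t \<le> \<rho> \<longrightarrow> (\<exists>z. ball z (a * t) \<subseteq> D \<inter> ball x t))"

lemma norm_minus_component_le:
  fixes v \<nu> :: "'a::euclidean_space"
  assumes "norm \<nu> = 1"
  shows "norm (v - (v \<bullet> \<nu>) *\<^sub>R \<nu>) \<le> norm v"
proof -
  have "\<nu> \<bullet> \<nu> = 1" using assms by (simp add: norm_eq_1)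
  then have "(norm (v - (v \<bullet> \<nu>) *\<^sub>R \<nu>))\<^sup>2 = (norm v)\<^sup>2 - (v \<bullet> \<nu>)\<^sup>2"
    unfolding power2_norm_eq_inner
    by (simp add: inner_diff_left inner_diff_right inner_commute power2_eq_square)
  then show ?thesis by (metis diff_le_eq le_add_same_cancel1 norm_ge_zero power2_le_imp_le zero_le_power2)
qed

text \<open>Moving from x by t/2 in the direction \<nu> gains height t/2 over the graph, whereas
  over a ball of radius a t the graph varies by at most L a t. For small \<open>a\<close> that ball
  therefore stays above the graph.\<close>

lemma corkscrew_near_boundary:
  fixes \<Omega> :: "'a::euclidean_space set"
  assumes "C1_boundary \<Omega>" "x0 \<in> frontier \<Omega>"
  shows "\<exists>a e. a > 0 \<and> e > 0 \<and>
    (\<forall>x\<in>\<Omega> \<inter> ball x0 e. \<forall>t. 0 < t \<and> t \<le> e \<longrightarrow> (\<exists>z. ball z (a * t) \<subseteq> \<Omega> \<inter> ball x t))"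
proof -
  obtain \<nu> r g where \<nu>: "norm \<nu> = 1" and r: "r > 0" and g: "C1_function g"
    and graph: "\<Omega> \<inter> ball x0 r = {x \<in> ball x0 r. g (x - (x \<bullet> \<nu>) *\<^sub>R \<nu>) < x \<bullet> \<nu>}"
    using assms unfolding C1_boundary_def by blast
  define P where "P x = x - (x \<bullet> \<nu>) *\<^sub>R \<nu>" for x
  have \<nu>\<nu>: "\<nu> \<bullet> \<nu> = 1" using \<nu> by (simp add: norm_eq_1)
  have P_diff: "P x - P y = P (x - y)" for x y
    by (simp add: P_def algebra_simps)
  have P_shift: "P (x + c *\<^sub>R \<nu>) = P x" for x c
    by (simp add: P_def \<nu>\<nu> algebra_simps)
  have P_le: "norm (P x) \<le> norm x" for x
    unfolding P_def by (rule norm_minus_component_le[OF \<nu>])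
  obtain L where L: "L \<ge> 0"
    "\<And>x y. x \<in> cball (P x0) r \<Longrightarrow> y \<in> cball (P x0) r \<Longrightarrow> \<bar>g x - g y\<bar> \<le> L * norm (x - y)"
    using C1_function_lipschitz_cball[OF g] by blast
  have P_cball: "P x \<in> cball (P x0) r" if "x \<in> ball x0 r" for x
  proof -
    have "norm (P x0 - P x) \<le> norm (x0 - x)" unfolding P_diff by (rule P_le)
    then show ?thesis using that by (simp add: dist_norm)
  qed
  \<comment> \<open>Chosen for two purposes: L a + a \<le> 1/2 keeps the ball of radius a t above
    the graph, and a \<le> 1/4 keeps it within distance t of x.\<close>
  define a where "a = 1 / (2 * (2 + L))"
  have a: "0 < a" "a \<le> 1/4" "L * a + a \<le> 1/2"
    using L(1) by (auto simp: a_def field_simps)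
  have "\<exists>z. ball z (a * t) \<subseteq> \<Omega> \<inter> ball x t"
    if x: "x \<in> \<Omega> \<inter> ball x0 (r/2)" and t: "0 < t" "t \<le> r/2" for x t
  proof (intro exI subsetI)
    \<comment> \<open>The centre left open by \<open>exI\<close> is x + (t/2) \<nu>.\<close>
    fix w assume "w \<in> ball (x + (t/2) *\<^sub>R \<nu>) (a * t)"
    then have w: "norm (w - (x + (t/2) *\<^sub>R \<nu>)) < a * t" by (simp add: dist_norm norm_minus_commute)
    have "norm (w - x) = norm ((w - (x + (t/2) *\<^sub>R \<nu>)) + (t/2) *\<^sub>R \<nu>)" by (simp add: algebra_simps)
    also have "\<dots> < a * t + t/2"
      using norm_triangle_ineq[of "w - (x + (t/2) *\<^sub>R \<nu>)" "(t/2) *\<^sub>R \<nu>"] w t \<nu> by simp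
    also have "\<dots> \<le> t" using mult_right_mono[OF a(2), of t] t by linarith
    finally have wx: "norm (w - x) < t" .
    have xr: "x \<in> ball x0 r" using x r by auto
    have wr: "w \<in> ball x0 r"
      using dist_triangle[of x0 w x] x wx t by (auto simp: dist_norm norm_minus_commute)
    have "P w - P x = P (w - (x + (t/2) *\<^sub>R \<nu>))"
      using P_diff[of w "x + (t/2) *\<^sub>R \<nu>"] P_shift[of x "t/2"] by simp
    then have "norm (P w - P x) \<le> a * t"
      using P_le[of "w - (x + (t/2) *\<^sub>R \<nu>)"] w by simp
    then have "L * norm (P w - P x) \<le> L * (a * t)" using L(1) by (rule mult_left_mono)
    then have 1: "g (P w) \<le> g (P x) + L * (a * t)"
      using L(2)[OF P_cball[OF wr] P_cball[OF xr]] by linarith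
    have "x \<in> \<Omega> \<inter> ball x0 r" using x xr by blast
    then have 2: "g (P x) < x \<bullet> \<nu>" unfolding graph P_def by blast
    have "\<bar>(w - (x + (t/2) *\<^sub>R \<nu>)) \<bullet> \<nu>\<bar> < a * t"
      using Cauchy_Schwarz_ineq2[of "w - (x + (t/2) *\<^sub>R \<nu>)" \<nu>] w \<nu> by simp
    then have 3: "w \<bullet> \<nu> > x \<bullet> \<nu> + t/2 - a * t"
      by (simp add: inner_diff_left inner_add_left \<nu>\<nu>)
    have "(L * a + a) * t \<le> 1/2 * t" using a(3) t by (intro mult_right_mono) auto
    then have "g (P w) < w \<bullet> \<nu>" using 1 2 3 by (simp add: algebra_simps)
    then have "w \<in> \<Omega> \<inter> ball x0 r" unfolding graph using wr by (simp add: P_def)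
    then show "w \<in> \<Omega> \<inter> ball x t" using wx by (simp add: dist_norm norm_minus_commute)
  qed
  then show ?thesis using a(1) half_gt_zero[OF r] by blast
qed

text \<open>The local constants become uniform because finitely many neighbourhoods cover the
  compact closure. The range of radii is then stretched from \<open>e\<close> to a length
  \<open>\<rho>\<close> exceeding all distances in the domain, at the price of a smaller ratio; the
  Poincare estimate uses one ball that contains the whole domain.\<close>

lemma bounded_C1_domain_corkscrew:
  fixes \<Omega> :: "'a::euclidean_space set"
  assumes "bounded_C1_domain \<Omega>"
  obtains a \<rho> where "a > 0" "\<rho> > 0" "corkscrew a \<rho> \<Omega>" "\<And>x. x \<in> \<Omega> \<Longrightarrow> \<Omega> \<subseteq> ball x \<rho>"
proof -
  have op: "open \<Omega>" and bd: "bounded \<Omega>" and C1: "C1_boundary \<Omega>" and ne: "\<Omega> \<noteq> {}"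
    using assms by (auto simp: bounded_C1_domain_def)
  have "\<exists>a e. a > 0 \<and> e > 0 \<and>
    (\<forall>x\<in>\<Omega> \<inter> ball x0 e. \<forall>t. 0 < t \<and> t \<le> e \<longrightarrow> (\<exists>z. ball z (a * t) \<subseteq> \<Omega> \<inter> ball x t))"
    if "x0 \<in> closure \<Omega>" for x0
  proof (cases "x0 \<in> \<Omega>")
    case True
    then obtain e where e: "e > 0" "ball x0 e \<subseteq> \<Omega>" using op open_contains_ball by blast
    have "ball x (1 * t) \<subseteq> \<Omega> \<inter> ball x t" if "x \<in> \<Omega> \<inter> ball x0 (e/2)" "0 < t \<and> t \<le> e/2" for x t
    proof -
      have "ball x t \<subseteq> ball x0 e"
      proof
        fix y assume "y \<in> ball x t"
        then show "y \<in> ball x0 e" using that dist_triangle[of x0 y x] by simp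
      qed
      then show ?thesis using e by auto
    qed
    then have "\<forall>x\<in>\<Omega> \<inter> ball x0 (e/2). \<forall>t. 0 < t \<and> t \<le> e/2 \<longrightarrow> (\<exists>z. ball z (1 * t) \<subseteq> \<Omega> \<inter> ball x t)"
      by blast
    then show ?thesis using e(1) by (meson half_gt_zero zero_less_one)
  next
    case False
    then have "x0 \<in> frontier \<Omega>" using that op by (simp add: frontier_def interior_open)
    then show ?thesis by (rule corkscrew_near_boundary[OF C1])
  qed
  then obtain A E where AE: "\<And>x0. x0 \<in> closure \<Omega> \<Longrightarrow> A x0 > 0 \<and> E x0 > (0::real) \<and>
    (\<forall>x\<in>\<Omega> \<inter> ball x0 (E x0). \<forall>t. 0 < t \<and> t \<le> E x0 \<longrightarrow> (\<exists>z. ball z (A x0 * t) \<subseteq> \<Omega> \<inter> ball x t))"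
    by metis
  have "compact (closure \<Omega>)" using bd by simp
  moreover have "closure \<Omega> \<subseteq> (\<Union>x0\<in>closure \<Omega>. ball x0 (E x0))" using AE by fastforce
  ultimately obtain K where K: "K \<subseteq> closure \<Omega>" "finite K" "closure \<Omega> \<subseteq> (\<Union>x0\<in>K. ball x0 (E x0))"
    using compactE_image[of "closure \<Omega>" "closure \<Omega>" "\<lambda>x0. ball x0 (E x0)"] open_ball by metis
  have Kne: "K \<noteq> {}" using K(3) ne closure_subset[of \<Omega>] by auto
  define a e where "a = Min (A ` K)" and "e = Min (E ` K)"
  have a: "a > 0" and e: "e > 0" using AE K Kne by (auto simp: a_def e_def)
  obtain R where R: "R > 0" "\<Omega> \<subseteq> ball 0 R" using bounded_subset_ballD[OF bd] by blast
  \<comment> \<open>2 R exceeds the distance of any two points of \<Omega>, and e \<le> \<rho>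
    ensures t' \<le> t below.\<close>
  define \<rho> where "\<rho> = max e (2 * R)"
  have \<rho>: "\<rho> > 0" "e \<le> \<rho>" using e by (auto simp: \<rho>_def)
  show thesis
  proof (rule that[of "a * e / \<rho>" \<rho>])
    show "a * e / \<rho> > 0" using a e \<rho> by simp
    show "corkscrew (a * e / \<rho>) \<rho> \<Omega>"
      unfolding corkscrew_def
    proof (intro ballI allI impI)
      fix x t assume x: "x \<in> \<Omega>" and t: "0 < t \<and> t \<le> \<rho>"
      obtain x0 where x0: "x0 \<in> K" "x \<in> ball x0 (E x0)" using K(3) x closure_subset by blast
      have "e \<le> E x0" "a \<le> A x0" using K(2) x0 by (auto simp: a_def e_def)
      \<comment> \<open>The contraction by e / \<rho> takes radii up to \<rho> to radii up to e,
        where the local statement applies; this is the extra factor in the ratio.\<close>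
      define t' where "t' = t * e / \<rho>"
      have t': "0 < t'" "t' \<le> e" "t' \<le> t" using t e \<rho> by (auto simp: t'_def field_simps)
      have "\<exists>z. ball z (A x0 * t') \<subseteq> \<Omega> \<inter> ball x t'"
        using AE[of x0] K(1) x0 x t' \<open>e \<le> E x0\<close> by (meson IntI dual_order.trans subsetD)
      then obtain z where z: "ball z (A x0 * t') \<subseteq> \<Omega> \<inter> ball x t'" by blast
      have "a * e / \<rho> * t = a * t'" by (simp add: t'_def)
      also have "\<dots> \<le> A x0 * t'" using \<open>a \<le> A x0\<close> t' by (simp add: mult_right_mono)
      finally have "ball z (a * e / \<rho> * t) \<subseteq> \<Omega> \<inter> ball x t'" using z subset_ball by blast
      then show "\<exists>z. ball z (a * e / \<rho> * t) \<subseteq> \<Omega> \<inter> ball x t"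
        using subset_ball[OF t'(3), of x] by blast
    qed
    show "\<Omega> \<subseteq> ball x \<rho>" if "x \<in> \<Omega>" for x
    proof
      fix y assume "y \<in> \<Omega>"
      then have "norm x < R" "norm y < R" using that R by auto
      then show "y \<in> ball x \<rho>" using norm_triangle_ineq4[of x y] by (auto simp: dist_norm \<rho>_def)
    qed
  qed (fact \<rho>)
qed

lemma corkscrew_scale:
  fixes D :: "'a::euclidean_space set"
  assumes "corkscrew a \<rho> D" "\<eta> > 0"
  shows "corkscrew a (\<eta> * \<rho>) ((\<lambda>x. \<eta> *\<^sub>R x) ` D)"
  unfolding corkscrew_def
proof (intro ballI allI impI)
  fix x t assume x: "x \<in> (\<lambda>x. \<eta> *\<^sub>R x) ` D" and t: "0 < t \<and> t \<le> \<eta> * \<rho>"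
  obtain y where y: "y \<in> D" "x = \<eta> *\<^sub>R y" using x by blast
  obtain z where z: "ball z (a * (t / \<eta>)) \<subseteq> D \<inter> ball y (t / \<eta>)"
    using assms y t unfolding corkscrew_def by (metis divide_pos_pos mult.commute pos_divide_le_eq)
  have sc: "(\<lambda>x. \<eta> *\<^sub>R x) ` ball v r = ball (\<eta> *\<^sub>R v) (\<eta> * r)" for v :: 'a and r
    using assms(2) by (simp add: ball_scale)
  have "ball (\<eta> *\<^sub>R z) (a * t) = (\<lambda>x. \<eta> *\<^sub>R x) ` ball z (a * (t / \<eta>))"
    unfolding sc using assms(2) by simp
  also have "\<dots> \<subseteq> (\<lambda>x. \<eta> *\<^sub>R x) ` D \<inter> (\<lambda>x. \<eta> *\<^sub>R x) ` ball y (t / \<eta>)" using z by blast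
  also have "\<dots> = (\<lambda>x. \<eta> *\<^sub>R x) ` D \<inter> ball x t"
    unfolding sc using assms(2) y by simp
  finally show "\<exists>z. ball z (a * t) \<subseteq> (\<lambda>x. \<eta> *\<^sub>R x) ` D \<inter> ball x t" by blast
qed

text \<open>Source of the density constant \<kappa>: the volume of the inner ball. It depends on
  \<open>a\<close> and the dimension, hence is unchanged by dilation.\<close>

lemma corkscrew_measure_ge:
  fixes D :: "'a::euclidean_space set"
  assumes "corkscrew a \<rho> D" "a > 0" "D \<in> sets lebesgue" "x \<in> D" "0 < t" "t \<le> \<rho>"
  shows "unit_ball_vol (DIM('a)) * a ^ DIM('a) * t ^ DIM('a) \<le> measure lebesgue (D \<inter> ball x t)"
proof -
  obtain z where z: "ball z (a * t) \<subseteq> D \<inter> ball x t" using assms unfolding corkscrew_def by blast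
  have "D \<inter> ball x t \<in> lmeasurable"
    using fmeasurable_Int_fmeasurable[OF lmeasurable_ball assms(3)] by (simp add: Int_commute)
  then have "measure lebesgue (ball z (a * t)) \<le> measure lebesgue (D \<inter> ball x t)"
    using z by (intro measure_mono_fmeasurable) auto
  then show ?thesis using content_ball[of "a * t" z] assms by (simp add: power_mult_distrib mult_ac)
qed

section \<open>Inequalities for real powers\<close>

text \<open>For |t| \<le> 1/2 the remainder is bounded by two mean value arguments on (0, 3/2],
  which gives the first summand of C. For larger |t| no smoothness is involved: |1 + t| \<le> 3 |t|
  gives 3^q, and - t \<le> 2 t^2 compensates a negative linear term, which gives 2 q.\<close>

lemma powr_second_order_one:
  fixes q t :: real
  assumes q: "q > 2" and C: "C = q * (q - 1) * (3/2) powr q + 3 powr q + 2 * q"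
  shows "\<bar>1 + t\<bar> powr q \<le> 1 + q * t + C * (t\<^sup>2 + \<bar>t\<bar> powr q)"
proof (cases "\<bar>t\<bar> \<le> 1/2")
  case True
  define x where "x = 1 + t"
  have x: "1/2 \<le> x" "x \<le> 3/2" using True by (auto simp: x_def)
  have der: "((\<lambda>z. z powr p) has_real_derivative p * z powr (p - 1)) (at z)" if "z > 0" for z p :: real
    using that by (auto intro!: derivative_eq_intros)
  have mvt: "\<exists>\<xi>>0. \<xi> \<le> 3/2 \<and> \<bar>\<xi> - 1\<bar> \<le> \<bar>t\<bar> \<and> x powr p - 1 = (x - 1) * (p * \<xi> powr (p - 1))" for p :: real
  proof (cases x "1::real" rule: linorder_cases)
    case less
    then obtain \<xi> where "\<xi> > x" "\<xi> < 1" "1 powr p - x powr p = (1 - x) * (p * \<xi> powr (p - 1))"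
      using MVT2[of x 1 "\<lambda>z. z powr p" "\<lambda>z. p * z powr (p - 1)"] der x by force
    then show ?thesis using x by (intro exI[of _ \<xi>]) (auto simp: algebra_simps x_def)
  next
    case equal then show ?thesis by (intro exI[of _ 1]) auto
  next
    case greater
    then obtain \<xi> where "\<xi> > 1" "\<xi> < x" "x powr p - 1 powr p = (x - 1) * (p * \<xi> powr (p - 1))"
      using MVT2[of 1 x "\<lambda>z. z powr p" "\<lambda>z. p * z powr (p - 1)"] der x by force
    then show ?thesis using x by (intro exI[of _ \<xi>]) (auto simp: algebra_simps x_def)
  qed
  have lip: "\<bar>\<xi> powr (q - 1) - 1\<bar> \<le> (q - 1) * (3/2) powr q * \<bar>t\<bar>"
    if xi: "\<xi> > 0" "\<xi> \<le> 3/2" "\<bar>\<xi> - 1\<bar> \<le> \<bar>t\<bar>" for \<xi>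
  proof -
    have d2: "norm (\<xi> powr (q - 1) - 1 powr (q - 1)) \<le> ((q - 1) * (3/2) powr q) * norm (\<xi> - 1)"
    proof (rule field_differentiable_bound[of "{0<..3/2}" "\<lambda>z. z powr (q-1)" "\<lambda>z. (q - 1) * z powr (q - 1 - 1)"])
      fix z :: real assume z: "z \<in> {0<..3/2}"
      show "((\<lambda>z. z powr (q - 1)) has_field_derivative (q - 1) * z powr (q - 1 - 1)) (at z within {0<..3/2})"
        using der[of z "q - 1"] z by (auto intro: has_field_derivative_at_within)
      have "z powr (q - 1 - 1) \<le> (3/2) powr (q - 1 - 1)" using z q by (intro powr_mono2) auto
      also have "\<dots> \<le> (3/2) powr q" by (intro powr_mono) auto
      finally show "norm ((q - 1) * z powr (q - 1 - 1)) \<le> (q - 1) * (3/2) powr q"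
        using q by (simp add: abs_mult)
    qed (use xi in auto)
    also have "\<dots> \<le> ((q - 1) * (3/2) powr q) * \<bar>t\<bar>" using xi q by (intro mult_left_mono) auto
    finally show ?thesis by simp
  qed
  obtain \<xi> where \<xi>: "\<xi> > 0" "\<xi> \<le> 3/2" "\<bar>\<xi> - 1\<bar> \<le> \<bar>t\<bar>" "x powr q - 1 = (x - 1) * (q * \<xi> powr (q - 1))"
    using mvt by blast
  have "x powr q - 1 - q * t = q * (t * (\<xi> powr (q - 1) - 1))"
    unfolding \<xi>(4) by (simp add: x_def algebra_simps)
  also have "\<dots> \<le> q * (\<bar>t\<bar> * \<bar>\<xi> powr (q - 1) - 1\<bar>)"
    using q by (intro mult_left_mono) (auto simp: abs_mult[symmetric])
  also have "\<dots> \<le> q * (\<bar>t\<bar> * ((q - 1) * (3/2) powr q * \<bar>t\<bar>))"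
    using q lip[OF \<xi>(1-3)] by (intro mult_left_mono) auto
  also have "\<dots> = q * (q - 1) * (3/2) powr q * t\<^sup>2" by (simp add: power2_eq_square mult_ac)
  also have "\<dots> \<le> C * t\<^sup>2" using q by (intro mult_right_mono) (auto simp: C)
  also have "\<dots> \<le> C * (t\<^sup>2 + \<bar>t\<bar> powr q)" using q by (intro mult_left_mono) (auto simp: C)
  finally show ?thesis using x by (simp add: x_def)
next
  case False
  have "\<bar>1 + t\<bar> powr q \<le> (3 * \<bar>t\<bar>) powr q" using False q by (intro powr_mono2) auto
  then have 1: "\<bar>1 + t\<bar> powr q \<le> 3 powr q * \<bar>t\<bar> powr q" by (simp add: powr_mult)
  have "1/2 * \<bar>t\<bar> \<le> \<bar>t\<bar> * \<bar>t\<bar>" using False by (intro mult_right_mono) auto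
  then have "- t \<le> 2 * t\<^sup>2" by (simp add: power2_eq_square)
  then have "q * (- t) \<le> q * (2 * t\<^sup>2)" using q by (intro mult_left_mono) auto
  then have 2: "0 \<le> 1 + q * t + 2 * q * t\<^sup>2" by simp
  have "(3 powr q) * \<bar>t\<bar> powr q + 2 * q * t\<^sup>2 \<le> C * \<bar>t\<bar> powr q + C * t\<^sup>2"
    using q by (intro add_mono mult_right_mono) (auto simp: C)
  then show ?thesis using 1 2 by (simp add: distrib_left)
qed

text \<open>By homogeneity: for nonzero m, factor out |m|^q and put t = h / m. The constant depends
  on q alone, so it is the same for all domains.\<close>

lemma powr_second_order:
  fixes q :: real
  assumes q: "q > 2"
  obtains C where "C > 0" "\<And>m h. \<bar>m + h\<bar> powr q \<le>
    \<bar>m\<bar> powr q + q * \<bar>m\<bar> powr (q - 2) * m * h + C * (\<bar>m\<bar> powr (q - 2) * h\<^sup>2 + \<bar>h\<bar> powr q)"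
proof -
  define C where "C = q * (q - 1) * (3/2) powr q + 3 powr q + 2 * q"
  have "C \<ge> 2 * q" unfolding C_def using q by simp
  \<comment> \<open>For m = 0 the claim reads |h|^q \<le> C |h|^q, which relies on C \<ge>
    1.\<close>
  then have C: "C > 1" using q by simp
  show thesis
  proof (rule that[of C])
    fix m h :: real
    show "\<bar>m + h\<bar> powr q \<le>
      \<bar>m\<bar> powr q + q * \<bar>m\<bar> powr (q - 2) * m * h + C * (\<bar>m\<bar> powr (q - 2) * h\<^sup>2 + \<bar>h\<bar> powr q)"
    proof (cases "m = 0")
      case True
      have "1 * \<bar>h\<bar> powr q \<le> C * \<bar>h\<bar> powr q" using C by (intro mult_right_mono) auto
      then show ?thesis using True by simp
    next
      case False
      define t where "t = h / m"
      have h: "h = m * t" using False by (simp add: t_def)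
      have m2: "\<bar>m\<bar> powr q = \<bar>m\<bar> powr (q - 2) * m\<^sup>2"
        using False powr_add[of "\<bar>m\<bar>" "q - 2" 2] by (simp add: powr_numeral)
      have "\<bar>m + h\<bar> powr q = \<bar>m\<bar> powr q * \<bar>1 + t\<bar> powr q"
        by (simp add: h powr_mult[symmetric] abs_mult[symmetric] algebra_simps)
      also have "\<dots> \<le> \<bar>m\<bar> powr q * (1 + q * t + C * (t\<^sup>2 + \<bar>t\<bar> powr q))"
        by (intro mult_left_mono powr_second_order_one[OF q C_def]) auto
      also have "\<dots> = \<bar>m\<bar> powr q + q * (\<bar>m\<bar> powr q * t) + C * (\<bar>m\<bar> powr q * t\<^sup>2 + \<bar>m\<bar> powr q * \<bar>t\<bar> powr q)"
        by (simp add: algebra_simps)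
      also have "\<bar>m\<bar> powr q * \<bar>t\<bar> powr q = \<bar>h\<bar> powr q" by (simp add: h abs_mult powr_mult)
      also have "\<bar>m\<bar> powr q * t = \<bar>m\<bar> powr (q - 2) * m * h" by (simp add: m2 h power2_eq_square mult_ac)
      also have "\<bar>m\<bar> powr q * t\<^sup>2 = \<bar>m\<bar> powr (q - 2) * h\<^sup>2" by (simp add: m2 h power2_eq_square mult_ac)
      finally show ?thesis by (simp add: mult_ac)
    qed
  qed (use C in simp)
qed

section \<open>Absorbing error terms into a single power\<close>

lemma powr_superadditive:
  fixes a b p :: real
  assumes "a \<ge> 0" "b \<ge> 0" "p \<ge> 1"
  shows "a powr p + b powr p \<le> (a + b) powr p"
proof (cases "a + b = 0")
  case True then have "a = 0" "b = 0" using assms by auto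
  then show ?thesis by simp
next
  case False
  then have ab: "a + b > 0" using assms by simp
  have *: "c powr p \<le> c * (a + b) powr (p - 1)" if "0 \<le> c" "c \<le> a + b" for c
  proof (cases "c = 0")
    case False
    then have "c powr p = c * c powr (p - 1)" using that powr_add[of c 1 "p - 1"] by simp
    also have "\<dots> \<le> c * (a + b) powr (p - 1)" using that assms by (intro mult_left_mono powr_mono2) auto
    finally show ?thesis .
  qed (use assms in simp)
  have "a powr p + b powr p \<le> (a + b) * (a + b) powr (p - 1)"
    using *[of a] *[of b] assms by (simp add: distrib_right)
  also have "\<dots> = (a + b) powr p" using ab powr_add[of "a + b" 1 "p - 1"] by simp
  finally show ?thesis .
qed

text \<open>The convex function z^p lies above its tangent at a. With a as the main term, this
  absorbs an error that carries the weight a^(p-1).\<close>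

lemma powr_bernoulli:
  fixes a b p :: real
  assumes "a \<ge> 0" "b \<ge> 0" "p > 1"
  shows "a powr p + p * a powr (p - 1) * b \<le> (a + b) powr p"
proof (cases "a = 0 \<or> b = 0")
  case True then show ?thesis using assms by auto
next
  case False
  then have ab: "a > 0" "b > 0" using assms by auto
  have "\<exists>z. a < z \<and> z < a + b \<and> (a + b) powr p - a powr p = (a + b - a) * (p * z powr (p - 1))"
    by (rule MVT2) (use ab in \<open>auto intro!: derivative_eq_intros\<close>)
  then obtain z where z: "a < z" "(a + b) powr p - a powr p = b * (p * z powr (p - 1))" by auto
  have "b * (p * a powr (p - 1)) \<le> b * (p * z powr (p - 1))"
    using ab z assms by (intro mult_left_mono powr_mono2) auto
  then show ?thesis using z by (simp add: mult_ac)
qed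

lemma power2_powr: "(m\<^sup>2) powr r = \<bar>m\<bar> powr (2 * r)" for m r :: real
proof (cases "m = 0")
  case False
  then have "m\<^sup>2 = \<bar>m\<bar> powr 2" by (simp add: powr_numeral)
  then show ?thesis by (metis powr_powr)
qed simp

text \<open>The algebra of Hedberg's optimization at a fixed point: f stands for
  \<open>nonlocal_density\<close>, A for the integral of |h|^q, t for a radius and T for a
  truncation level. The aim is a bound linear in f, which can be integrated, times a power of A with
  exponent below 1, which can be absorbed.\<close>

lemma sobolev_scale_choice:
  fixes n s \<kappa> \<rho> A f h q :: real
  assumes s: "0 < s" "2 * s < n" and q: "q = 2 * n / (n - 2 * s)"
    and pos: "\<kappa> > 0" "\<rho> > 0" "A > 0" "f \<ge> 0"
    and small: "\<And>t T. 0 < t \<Longrightarrow> t \<le> \<rho> \<Longrightarrow> 0 < T \<Longrightarrow>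
      h\<^sup>2 \<le> 2 * t powr (2 * s) * f / \<kappa> + 2 * T\<^sup>2 + 2 * T powr (2 - q) * A / (\<kappa> * t powr n)"
    and large: "h\<^sup>2 \<le> \<rho> powr (2 * s) * f / \<kappa>"
  shows "\<bar>h\<bar> powr q \<le> (2 / \<kappa> + 4 * \<kappa> powr (- 2 / q)) powr (q / 2) * A powr (2 * s / n) * f"
proof (cases "f = 0")
  case True
  then have "h = 0" using large by simp
  then show ?thesis using True by simp
next
  case False
  then have f: "f > 0" using pos by simp
  have n: "n > 0" using s by simp
  have q2: "q > 2" using s by (simp add: q field_simps)
  have q1: "2 / q = 1 - 2 * s / n" using s n by (simp add: q field_simps)
  define C where "C = 2 / \<kappa> + 4 * \<kappa> powr (- 2 / q)"
  \<comment> \<open>The radius at which t^(2s) f equals (A / t^n)^(2/q), the orders of the two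
    competing terms; B is their common value.\<close>
  define t where "t = (A powr (2 / q) / f) powr (1 / n)"
  have t: "t > 0" using pos f by (simp add: t_def)
  have tn: "t powr n = A powr (2 / q) / f" using n f by (simp add: t_def powr_powr)
  define B where "B = t powr (2 * s) * f"
  have B: "B > 0" using t f by (simp add: B_def)
  have "t powr (2 * s) = (t powr n) powr (2 * s / n)" using n by (simp add: powr_powr)
  also have "\<dots> = (A powr (2 / q)) powr (2 * s / n) / f powr (2 * s / n)"
    unfolding tn using f by (simp add: powr_divide)
  finally have B_eq: "B = (A powr (2 / q)) powr (2 * s / n) * f powr (2 / q)"
    using f by (simp add: B_def q1 powr_diff)
  have h_le: "h\<^sup>2 \<le> C * B"
  proof (cases "t \<le> \<rho>")
    case True
    \<comment> \<open>T^q is the bound for the mean of |h|^q over the ball; with this choice the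
      last two terms of \<open>small\<close> both equal 2 T^2.\<close>
    define T where "T = (A / (\<kappa> * t powr n)) powr (1 / q)"
    have T: "T > 0" using pos t by (simp add: T_def)
    have Tq: "T powr q = A / (\<kappa> * t powr n)" using q2 pos t by (simp add: T_def powr_powr)
    have "T\<^sup>2 = T powr 2" using T by (simp add: powr_numeral)
    also have "\<dots> = (T powr q) powr (2 / q)" using q2 by (simp add: powr_powr)
    also have "\<dots> = (A powr (1 - 2 / q) * (f / \<kappa>)) powr (2 / q)"
      unfolding Tq tn using pos f by (simp add: powr_diff field_simps)
    also have "\<dots> = \<kappa> powr (- 2 / q) * B"
    proof -
      have "\<kappa> powr (- 2 / q) = 1 / \<kappa> powr (2 / q)" using powr_minus_divide[of \<kappa> "2 / q"] by simp
      moreover have "2 * s / n = 1 - 2 / q" using q1 by simp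
      ultimately show ?thesis
        unfolding B_eq using pos f by (simp add: powr_mult powr_divide powr_powr mult_ac)
    qed
    finally have T2: "T\<^sup>2 = \<kappa> powr (- 2 / q) * B" .
    have "T powr (2 - q) * A / (\<kappa> * t powr n) = T powr (2 - q) * T powr q" by (simp add: Tq)
    also have "\<dots> = T\<^sup>2" using T by (simp add: powr_add[symmetric] powr_numeral)
    finally have "h\<^sup>2 \<le> 2 * B / \<kappa> + 2 * T\<^sup>2 + 2 * T\<^sup>2"
      using small[OF t True T] by (simp add: B_def mult_ac)
    also have "\<dots> = C * B" by (simp add: T2 C_def algebra_simps)
    finally show ?thesis .
  next
    case False
    \<comment> \<open>If the balancing radius exceeds \<rho>, the global estimate
      \<open>large\<close> is good enough, because \<rho>^(2s) f \<le> t^(2s) f.\<close>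
    then have "\<rho> powr (2 * s) * f \<le> B" unfolding B_def
      using pos s f by (intro mult_right_mono powr_mono2) auto
    then have "h\<^sup>2 \<le> B / \<kappa>" using large pos(1) by (meson divide_right_mono less_imp_le order_trans)
    also have "\<dots> \<le> C * B"
    proof -
      have "0 \<le> B / \<kappa>" "0 \<le> \<kappa> powr (- 2 / q) * B" using B pos by auto
      moreover have "C * B = 2 * (B / \<kappa>) + 4 * (\<kappa> powr (- 2 / q) * B)"
        by (simp add: C_def distrib_right)
      ultimately show ?thesis by linarith
    qed
    finally show ?thesis .
  qed
  have C: "C > 0" using pos by (simp add: C_def add_pos_nonneg)
  have "\<bar>h\<bar> powr q = (h\<^sup>2) powr (q / 2)"
    by (simp add: power2_powr)
  also have "\<dots> \<le> (C * B) powr (q / 2)" using h_le q2 by (intro powr_mono2) auto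
  also have "\<dots> = C powr (q / 2) * B powr (q / 2)" using C B by (simp add: powr_mult)
  also have "B powr (q / 2) = A powr (2 * s / n) * f"
    unfolding B_eq using pos f q2 by (simp add: powr_mult powr_powr)
  finally show ?thesis by (simp add: C_def mult_ac)
qed

text \<open>With p = q / 2 the left side is at most a^p + a^(p-1) b + c^p, where a carries m^2, and
  b and c are multiples of g. Bernoulli's inequality absorbs the middle term and superadditivity the
  last, while the coefficient of m^2 stays V^(2/q).\<close>

lemma sobolev_combine:
  fixes n s \<kappa> \<rho> A g q V C C1 m :: real
  assumes s: "0 < s" "2 * s < n" and q: "q = 2 * n / (n - 2 * s)"
    and pos: "\<kappa> > 0" "\<rho> > 0" "A \<ge> 0" "g \<ge> 0" "C > 0" "C1 > 0"
    and V: "\<kappa> * \<rho> powr n \<le> V"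
    and A: "A powr (2 / q) \<le> C * g"
  shows "V * \<bar>m\<bar> powr q + C1 * (\<bar>m\<bar> powr (q - 2) * (\<rho> powr (2 * s) * g / \<kappa>) + A) \<le>
    (V powr (2 / q) * m\<^sup>2 + (C1 / (\<kappa> * \<kappa> powr (2 * s / n)) + C1 powr (2 / q) * C) * g) powr (q / 2)"
proof -
  have n: "n > 0" using s by simp
  have q2: "q > 2" using s by (simp add: q field_simps)
  have q1: "2 / q = 1 - 2 * s / n" using s n by (simp add: q field_simps)
  have "0 < \<kappa> * \<rho> powr n" using pos by simp
  with V have V0: "V > 0" by linarith
  define p where "p = q / 2"
  have p: "p > 1" using q2 by (simp add: p_def)
  define a where "a = V powr (2 / q) * m\<^sup>2"
  define b where "b = C1 / (\<kappa> * \<kappa> powr (2 * s / n)) * g"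
  define c where "c = C1 powr (2 / q) * C * g"
  have abc: "a \<ge> 0" "b \<ge> 0" "c \<ge> 0" using pos by (auto simp: a_def b_def c_def)
  have ap: "a powr p = V * \<bar>m\<bar> powr q"
    using V0 q2 by (simp add: a_def powr_mult powr_powr power2_powr p_def)
  have "2 / q * (p - 1) = 1 - 2 / q" using q2 by (simp add: p_def field_simps)
  then have "2 / q * (p - 1) = 2 * s / n" using q1 by simp
  moreover have "2 * (p - 1) = q - 2" by (simp add: p_def)
  ultimately have ap1: "a powr (p - 1) = V powr (2 * s / n) * \<bar>m\<bar> powr (q - 2)"
    using V0 by (simp add: a_def powr_mult powr_powr power2_powr)
  \<comment> \<open>Here the length scale cancels: V \<ge> \<kappa> \<rho>^n trades \<rho>^(2s) for
    V^(2s/n), a factor of a^(p-1), and b retains powers of \<kappa> only.\<close>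
  have "(\<kappa> * \<rho> powr n) powr (2 * s / n) \<le> V powr (2 * s / n)"
    using V s n pos by (intro powr_mono2) auto
  then have "\<kappa> powr (2 * s / n) * \<rho> powr (2 * s) \<le> V powr (2 * s / n)"
    using n pos by (simp add: powr_mult powr_powr)
  then have "\<kappa> powr (2 * s / n) * \<rho> powr (2 * s) * (\<bar>m\<bar> powr (q - 2) * b) \<le> V powr (2 * s / n) * (\<bar>m\<bar> powr (q - 2) * b)"
    using abc by (intro mult_right_mono) auto
  moreover have "\<kappa> powr (2 * s / n) * \<rho> powr (2 * s) * (\<bar>m\<bar> powr (q - 2) * b)
      = C1 * (\<bar>m\<bar> powr (q - 2) * (\<rho> powr (2 * s) * g / \<kappa>))"
    using pos by (simp add: b_def field_simps)
  ultimately have "C1 * (\<bar>m\<bar> powr (q - 2) * (\<rho> powr (2 * s) * g / \<kappa>)) \<le> a powr (p - 1) * b"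
    by (simp add: ap1 mult_ac)
  also have "\<dots> \<le> p * a powr (p - 1) * b"
    using mult_right_mono[of 1 p "a powr (p - 1) * b"] p abc by (simp add: mult_ac)
  finally have 1: "V * \<bar>m\<bar> powr q + C1 * (\<bar>m\<bar> powr (q - 2) * (\<rho> powr (2 * s) * g / \<kappa>)) \<le> (a + b) powr p"
    using powr_bernoulli[OF abc(1,2) p] ap by linarith
  have "A = (A powr (2 / q)) powr p" using q2 pos by (simp add: powr_powr p_def)
  also have "\<dots> \<le> (C * g) powr p" using A p by (intro powr_mono2) auto
  finally have "C1 * A \<le> C1 * (C * g) powr p" using pos by (intro mult_left_mono) auto
  also have "\<dots> = c powr p"
    using pos q2 by (simp add: c_def powr_mult powr_powr p_def mult_ac)
  finally have "C1 * A \<le> c powr p" .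
  then have "V * \<bar>m\<bar> powr q + C1 * (\<bar>m\<bar> powr (q - 2) * (\<rho> powr (2 * s) * g / \<kappa>) + A) \<le> (a + b + c) powr p"
    using 1 powr_superadditive[of "a + b" c p] abc p by (simp add: distrib_left)
  moreover have "a + b + c = V powr (2 / q) * m\<^sup>2 + (C1 / (\<kappa> * \<kappa> powr (2 * s / n)) + C1 powr (2 / q) * C) * g"
    by (simp add: a_def b_def c_def distrib_right)
  ultimately show ?thesis by (simp add: p_def)
qed

section \<open>A fractional Sobolev-Poincare inequality\<close>

text \<open>The inner integral of the Gagliardo seminorm over D \<times> D. It takes values in
  \<open>ennreal\<close>, as it may be infinite at some points, and uses \<open>lborel\<close> so
  that Tonelli's theorem applies directly.\<close>

definition nonlocal_density :: "real \<Rightarrow> 'a::euclidean_space set \<Rightarrow> ('a \<Rightarrow> real) \<Rightarrow> 'a \<Rightarrow> ennreal" where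
  "nonlocal_density s D u x =
     (\<integral>\<^sup>+y\<in>D. ennreal ((u x - u y)\<^sup>2 / norm (x - y) powr (real DIM('a) + 2 * s)) \<partial>lborel)"

lemma nonlocal_density_measurable [measurable]:
  assumes [measurable]: "u \<in> borel_measurable borel" "D \<in> sets borel"
  shows "nonlocal_density s D u \<in> borel_measurable borel"
  unfolding nonlocal_density_def by measurable

lemma set_integrable_bounded:
  fixes g :: "'a::euclidean_space \<Rightarrow> real"
  assumes "g \<in> borel_measurable borel" "\<And>x. \<bar>g x\<bar> \<le> B" "E \<in> sets borel" "emeasure lborel E < \<infinity>"
  shows "set_integrable lborel E g"
  unfolding set_integrable_def
  by (rule integrableI_bounded_set_indicator[where B=B]) (use assms in auto)

lemma set_nn_integral_eq_set_integral_nonneg: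
  fixes g :: "'a::euclidean_space \<Rightarrow> real"
  assumes "set_integrable lborel E g" "\<And>x. g x \<ge> 0"
  shows "(\<integral>\<^sup>+x\<in>E. ennreal (g x) \<partial>lborel) = ennreal (LINT x:E|lborel. g x)"
proof -
  have "(\<integral>\<^sup>+x\<in>E. ennreal (g x) \<partial>lborel) = (\<integral>\<^sup>+x. ennreal (indicator E x *\<^sub>R g x) \<partial>lborel)"
    by (intro nn_integral_cong) (auto split: split_indicator)
  also have "\<dots> = ennreal (\<integral>x. indicator E x *\<^sub>R g x \<partial>lborel)"
    using assms by (intro nn_integral_eq_integral) (auto simp: set_integrable_def)
  finally show ?thesis by (simp add: set_lebesgue_integral_def)
qed

lemma square_diff_bounded:
  fixes a b B :: real
  assumes "\<bar>a\<bar> \<le> B" "\<bar>b\<bar> \<le> B"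
  shows "\<bar>(a - b)\<^sup>2\<bar> \<le> (2 * B)\<^sup>2"
  using power_mono[of "\<bar>a - b\<bar>" "2 * B" 2] assms by simp

text \<open>Measure density at all scales up to \<rho>, where \<rho> is so large that every ball of
  this radius about a point of D covers D. A dilation by \<eta> changes \<rho> to \<eta> \<rho> and
  keeps \<kappa>, so constants built from \<kappa>, s, n and q serve every dilate.\<close>

locale fat_domain =
  fixes D :: "'a::euclidean_space set" and \<kappa> \<rho> s n q :: real
  assumes n: "n = real DIM('a)" and q: "q = 2 * n / (n - 2 * s)"
    and s: "0 < s" "2 * s < n"
    and D: "D \<in> sets borel" "D \<noteq> {}"
    and pos: "\<kappa> > 0" "\<rho> > 0"
    and fat: "\<And>x t. x \<in> D \<Longrightarrow> 0 < t \<Longrightarrow> t \<le> \<rho> \<Longrightarrow> \<kappa> * t ^ DIM('a) \<le> measure lborel (D \<inter> ball x t)"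
    and small: "\<And>x. x \<in> D \<Longrightarrow> D \<subseteq> ball x \<rho>"
begin

lemmas D_measurable [measurable] = D(1)

abbreviation "V \<equiv> measure lborel D"

lemma q_gt_2: "q > 2"
  using s by (simp add: q field_simps)

lemma pow_DIM: "t ^ DIM('a) = t powr n" if "t > 0" for t :: real
  using that by (simp add: n powr_realpow)

lemma finite_emeasure: "E \<subseteq> D \<Longrightarrow> emeasure lborel E < \<infinity>"
proof -
  assume E: "E \<subseteq> D"
  obtain x where "x \<in> D" using D by blast
  then have "emeasure lborel E \<le> emeasure lborel (ball x \<rho>)"
    using E small by (intro emeasure_mono) auto
  then show ?thesis using emeasure_lborel_ball_finite[of x \<rho>] by (rule le_less_trans)
qed

lemma V_ge: "\<kappa> * \<rho> powr n \<le> V"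
proof -
  obtain x where x: "x \<in> D" using D by blast
  then have "D \<inter> ball x \<rho> = D" using small by auto
  then show ?thesis using fat[OF x pos(2)] pos by (simp add: pow_DIM)
qed

lemma V_pos: "V > 0"
proof -
  have "0 < \<kappa> * \<rho> powr n" using pos by simp
  then show ?thesis using V_ge by linarith
qed

text \<open>For y in the ball the kernel is at least (u x - u y)^2 / t^(n + 2s), so the density at x
  controls the local oscillation.\<close>

lemma local_oscillation_le:
  assumes u [measurable]: "u \<in> borel_measurable borel" and "\<And>x. \<bar>u x\<bar> \<le> B"
    and E: "E \<in> sets borel" "E \<subseteq> D \<inter> ball x t" and t: "t > 0"
    and fin: "nonlocal_density s D u x < \<infinity>"
  shows "(LINT y:E|lborel. (u x - u y)\<^sup>2) \<le> t powr (n + 2 * s) * enn2real (nonlocal_density s D u x)"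
proof -
  let ?k = "\<lambda>y. (u x - u y)\<^sup>2 / norm (x - y) powr (n + 2 * s)"
  have "\<bar>(u x - u y)\<^sup>2\<bar> \<le> (2 * B)\<^sup>2" for y
    by (intro square_diff_bounded assms(2))
  then have int: "set_integrable lborel E (\<lambda>y. (u x - u y)\<^sup>2)"
    using E finite_emeasure[of E] by (intro set_integrable_bounded[where B="(2 * B)\<^sup>2"]) auto
  have "ennreal (LINT y:E|lborel. (u x - u y)\<^sup>2) = (\<integral>\<^sup>+y\<in>E. ennreal ((u x - u y)\<^sup>2) \<partial>lborel)"
    using int by (subst set_nn_integral_eq_set_integral_nonneg) auto
  also have "\<dots> \<le> (\<integral>\<^sup>+y. ennreal (t powr (n + 2 * s)) * (ennreal (?k y) * indicator D y) \<partial>lborel)"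
  proof (intro nn_integral_mono)
    fix y
    show "ennreal ((u x - u y)\<^sup>2) * indicator E y \<le> ennreal (t powr (n + 2 * s)) * (ennreal (?k y) * indicator D y)"
    \<comment> \<open>At y = x the left side vanishes, so the value of the kernel on the diagonal
      does not matter.\<close>
    proof (cases "y \<in> E \<and> y \<noteq> x")
      case True
      then have y: "y \<in> D" "norm (x - y) < t" "norm (x - y) > 0" using E by (auto simp: dist_norm)
      have "(u x - u y)\<^sup>2 = norm (x - y) powr (n + 2 * s) * ?k y" using y by simp
      also have "\<dots> \<le> t powr (n + 2 * s) * ?k y"
        using y s by (intro mult_right_mono powr_mono2) auto
      finally show ?thesis using y True by (simp add: ennreal_leI ennreal_mult[symmetric])
    qed (auto split: split_indicator)
  qed
  also have "\<dots> = ennreal (t powr (n + 2 * s)) * nonlocal_density s D u x"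
    unfolding nonlocal_density_def n[symmetric] using D by (intro nn_integral_cmult) measurable
  also have "\<dots> = ennreal (t powr (n + 2 * s) * enn2real (nonlocal_density s D u x))"
    using fin by (simp add: ennreal_mult less_top)
  finally show ?thesis by (simp add: ennreal_le_iff)
qed

text \<open>
  Hedberg's argument: compare \<open>u x - m\<close> with its mean square over the ball of radius \<open>t\<close> around \<open>x\<close>,
  and choose \<open>t\<close> depending on \<open>x\<close>. The resulting bound contains a power less than 1 of the quantity
  \<open>A\<close> to be estimated, and \<open>A\<close> is finite because \<open>u\<close> is bounded.
\<close>

lemma sobolev_poincare_bounded:
  assumes u [measurable]: "u \<in> borel_measurable borel" and bd: "\<And>x. \<bar>u x\<bar> \<le> B"
    and G: "(\<integral>\<^sup>+x\<in>D. nonlocal_density s D u x \<partial>lborel) < \<infinity>"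
  defines "g \<equiv> enn2real (\<integral>\<^sup>+x\<in>D. nonlocal_density s D u x \<partial>lborel)"
    and "m \<equiv> (LINT x:D|lborel. u x) / V"
  shows "(LINT x:D|lborel. \<bar>u x - m\<bar> powr q) powr (2 / q)
           \<le> (2 / \<kappa> + 4 * \<kappa> powr (- 2 / q)) powr (q / 2) * g"
    and "(LINT x:D|lborel. (u x - m)\<^sup>2) \<le> \<rho> powr (2 * s) * g / \<kappa>"
proof -
  define F where "F x = nonlocal_density s D u x" for x
  define f where "f x = enn2real (F x)" for x
  define h where "h x = u x - m" for x
  define A where "A = (LINT x:D|lborel. \<bar>h x\<bar> powr q)"
  define M where "M = B + \<bar>m\<bar>"
  have [measurable]: "F \<in> borel_measurable borel" "h \<in> borel_measurable borel"
    unfolding F_def h_def by measurable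
  have g_eq: "ennreal g = (\<integral>\<^sup>+x\<in>D. F x \<partial>lborel)" using G by (simp add: g_def F_def less_top)
  have g0: "g \<ge> 0" by (simp add: g_def)
  have h_bd: "\<bar>h x\<bar> \<le> M" for x using bd[of x] by (simp add: h_def M_def)
  have h2_bd: "\<bar>(h x)\<^sup>2\<bar> \<le> M\<^sup>2" for x
    using h_bd[of x] by (simp add: abs_le_square_iff[symmetric])
  have hq_bd: "\<bar>\<bar>h x\<bar> powr q\<bar> \<le> M powr q" for x
    using h_bd[of x] q_gt_2 by (simp add: powr_mono2)
  have diff_bd: "\<bar>(u x - u y)\<^sup>2\<bar> \<le> (2 * B)\<^sup>2" for x y
    by (intro square_diff_bounded bd)
  have ints: "set_integrable lborel E u" "set_integrable lborel E h" "set_integrable lborel E (\<lambda>y. (h y)\<^sup>2)"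
      "set_integrable lborel E (\<lambda>y. \<bar>h y\<bar> powr q)" "set_integrable lborel E (\<lambda>y. (u x - u y)\<^sup>2)"
      "set_integrable lborel E (\<lambda>y. c)"
    if "E \<in> sets borel" "E \<subseteq> D" for E x and c :: real
  proof -
    note bi = set_integrable_bounded[OF _ _ that(1) finite_emeasure[OF that(2)]]
    show "set_integrable lborel E u" "set_integrable lborel E h" "set_integrable lborel E (\<lambda>y. (h y)\<^sup>2)"
      "set_integrable lborel E (\<lambda>y. \<bar>h y\<bar> powr q)" "set_integrable lborel E (\<lambda>y. (u x - u y)\<^sup>2)"
      "set_integrable lborel E (\<lambda>y. c)"
      by (rule bi[OF _ bd] bi[OF _ h_bd] bi[OF _ h2_bd] bi[OF _ hq_bd] bi[OF _ diff_bd]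
          bi[OF _ order_refl], measurable)+
  qed
  have const: "(LINT y:E|lborel. c) = measure lborel E * c" if "E \<in> sets borel" "E \<subseteq> D" for E and c :: real
    using finite_emeasure[OF that(2)] that by (simp add: set_lebesgue_integral_def less_top)
  have A0: "A \<ge> 0" unfolding A_def set_lebesgue_integral_def by (intro Bochner_Integration.integral_nonneg) simp
  have h_mean: "(LINT y:D|lborel. h y) = 0"
    unfolding h_def using ints[of D] const[of D m] V_pos by (simp add: set_integral_diff m_def)
  have f0: "f x \<ge> 0" for x by (simp add: f_def)
  have large: "(h x)\<^sup>2 \<le> \<rho> powr (2 * s) * f x / \<kappa>" if x: "x \<in> D" and fin: "F x < \<infinity>" for x
  proof -
    \<comment> \<open>As h has mean zero, the cross term integrates to 0. The integrand is (h x - h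
      y)^2 with the nonnegative (h y)^2 dropped, and h x - h y = u x - u y.\<close>
    have "V * (h x)\<^sup>2 = (LINT y:D|lborel. (h x)\<^sup>2 - 2 * h x * h y)"
      using ints[of D] by (simp add: set_integral_diff set_integral_mult_right const h_mean)
    also have "\<dots> \<le> (LINT y:D|lborel. (u x - u y)\<^sup>2)"
    proof (rule set_integral_mono)
      show "(h x)\<^sup>2 - 2 * h x * h y \<le> (u x - u y)\<^sup>2" for y
        using zero_le_power2[of "h y"] by (simp add: h_def power2_eq_square algebra_simps)
    qed (use ints[of D] in \<open>auto intro!: set_integral_diff\<close>)
    also have "\<dots> \<le> \<rho> powr (n + 2 * s) * f x"
      unfolding f_def F_def using small[OF x] fin pos
      by (intro local_oscillation_le[OF u bd]) (auto simp: F_def)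
    finally have 1: "V * (h x)\<^sup>2 \<le> \<rho> powr n * (\<rho> powr (2 * s) * f x)" by (simp add: powr_add mult_ac)
    have "\<kappa> * \<rho> powr n * (h x)\<^sup>2 \<le> V * (h x)\<^sup>2" using V_ge by (intro mult_right_mono) auto
    then have "\<rho> powr n * (\<kappa> * (h x)\<^sup>2) \<le> \<rho> powr n * (\<rho> powr (2 * s) * f x)" using 1 by (simp add: mult_ac)
    then have "\<kappa> * (h x)\<^sup>2 \<le> \<rho> powr (2 * s) * f x" using pos by (simp add: mult_le_cancel_left_pos)
    then show ?thesis using pos by (simp add: pos_le_divide_eq mult.commute)
  qed
  have at_scale: "(h x)\<^sup>2 \<le> 2 * t powr (2 * s) * f x / \<kappa> + 2 * T\<^sup>2 + 2 * T powr (2 - q) * A / (\<kappa> * t powr n)"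
    if x: "x \<in> D" and fin: "F x < \<infinity>" and t: "0 < t" "t \<le> \<rho>" and T: "0 < T" for x t T
  proof -
    define E where "E = D \<inter> ball x t"
    have E: "E \<in> sets borel" "E \<subseteq> D" by (auto simp: E_def)
    define e where "e = measure lborel E"
    have e: "\<kappa> * t powr n \<le> e" using fat[OF x t] t by (simp add: e_def E_def pow_DIM)
    have kt: "0 < \<kappa> * t powr n" using pos t by simp
    then have e0: "e > 0" using e by linarith
    \<comment> \<open>Where |h y| exceeds T, the negative exponent 2 - q turns the square into a
      q-th power, whose integral over the ball is at most A.\<close>
    have split_T: "(h y)\<^sup>2 \<le> T\<^sup>2 + T powr (2 - q) * \<bar>h y\<bar> powr q" for y
    proof (cases "\<bar>h y\<bar> \<le> T")
      case True
      then have "(h y)\<^sup>2 \<le> T\<^sup>2" using T by (simp add: abs_le_square_iff[symmetric])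
      then show ?thesis by (simp add: add_increasing2)
    next
      case False
      then have hy: "\<bar>h y\<bar> > 0" using T by simp
      have "(h y)\<^sup>2 = \<bar>h y\<bar> powr (2 - q) * \<bar>h y\<bar> powr q"
        using hy by (simp add: powr_add[symmetric] powr_numeral)
      also have "\<dots> \<le> T powr (2 - q) * \<bar>h y\<bar> powr q"
        using False T q_gt_2 by (intro mult_right_mono powr_mono2') auto
      finally show ?thesis by (simp add: add_increasing)
    qed
    have "e * (h x)\<^sup>2 = (LINT y:E|lborel. (h x)\<^sup>2)" using const[OF E] by (simp add: e_def)
    also have "\<dots> \<le> (LINT y:E|lborel. 2 * (u x - u y)\<^sup>2 + (2 * T\<^sup>2 + 2 * T powr (2 - q) * \<bar>h y\<bar> powr q))"
    proof (rule set_integral_mono)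
      fix y
      have "(h x)\<^sup>2 \<le> 2 * (u x - u y)\<^sup>2 + 2 * (h y)\<^sup>2"
        using zero_le_power2[of "(u x - u y) - h y"] by (simp add: h_def power2_eq_square algebra_simps)
      then show "(h x)\<^sup>2 \<le> 2 * (u x - u y)\<^sup>2 + (2 * T\<^sup>2 + 2 * T powr (2 - q) * \<bar>h y\<bar> powr q)"
        using split_T[of y] by simp
    qed (use ints[OF E] in \<open>auto intro!: set_integral_add\<close>)
    also have "\<dots> = 2 * (LINT y:E|lborel. (u x - u y)\<^sup>2) + (e * (2 * T\<^sup>2) + 2 * T powr (2 - q) * (LINT y:E|lborel. \<bar>h y\<bar> powr q))"
      using ints[OF E] by (simp add: set_integral_add const[OF E] e_def set_integral_mult_right)
    finally have 1: "e * (h x)\<^sup>2 \<le> \<dots>" .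
    have 2: "(LINT y:E|lborel. (u x - u y)\<^sup>2) \<le> t powr (n + 2 * s) * f x"
      unfolding f_def F_def using E fin t
      by (intro local_oscillation_le[OF u bd]) (auto simp: F_def E_def)
    have "(LINT y:E|lborel. \<bar>h y\<bar> powr q) \<le> A"
      unfolding A_def set_lebesgue_integral_def using ints(4)[OF E] ints(4)[of D] E
      by (intro integral_mono) (auto simp: set_integrable_def split: split_indicator)
    then have "2 * T powr (2 - q) * (LINT y:E|lborel. \<bar>h y\<bar> powr q) \<le> 2 * T powr (2 - q) * A"
      by (intro mult_left_mono) auto
    with 1 2 have "e * (h x)\<^sup>2 \<le> 2 * (t powr (n + 2 * s) * f x) + (e * (2 * T\<^sup>2) + 2 * T powr (2 - q) * A)"
      by linarith
    then have "(h x)\<^sup>2 \<le> (2 * (t powr (n + 2 * s) * f x) + (e * (2 * T\<^sup>2) + 2 * T powr (2 - q) * A)) / e"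
      using e0 by (simp add: pos_le_divide_eq mult.commute)
    also have "\<dots> = 2 * (t powr (n + 2 * s) * f x) / e + 2 * T\<^sup>2 + 2 * T powr (2 - q) * A / e"
      using e0 by (simp add: add_divide_distrib)
    also have "\<dots> \<le> 2 * (t powr (n + 2 * s) * f x) / (\<kappa> * t powr n) + 2 * T\<^sup>2 + 2 * T powr (2 - q) * A / (\<kappa> * t powr n)"
      using e kt f0 A0 by (intro add_mono divide_left_mono) auto
    also have "2 * (t powr (n + 2 * s) * f x) / (\<kappa> * t powr n) = 2 * t powr (2 * s) * f x / \<kappa>"
      using t pos by (simp add: powr_add field_simps)
    finally show ?thesis .
  qed
  have "AE x in lborel. F x * indicator D x \<noteq> \<infinity>"
    using G unfolding F_def[symmetric] by (intro nn_integral_PInf_AE) auto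
  then have F_fin: "AE x in lborel. x \<in> D \<longrightarrow> F x < \<infinity>"
    by (rule AE_mp) (auto intro!: AE_I2 simp: less_top)
  have F_eq: "F x = ennreal (f x)" if "F x < \<infinity>" for x using that by (simp add: f_def less_top)
  have int_le: "(LINT x:D|lborel. w x) \<le> c * g"
    if w: "set_integrable lborel D w" "\<And>x. w x \<ge> 0" and c: "c \<ge> 0"
      and wle: "\<And>x. x \<in> D \<Longrightarrow> F x < \<infinity> \<Longrightarrow> w x \<le> c * f x" for w c
  proof -
    have "ennreal (LINT x:D|lborel. w x) = (\<integral>\<^sup>+x\<in>D. ennreal (w x) \<partial>lborel)"
      using w by (subst set_nn_integral_eq_set_integral_nonneg) auto
    also have "\<dots> \<le> (\<integral>\<^sup>+x. ennreal c * (F x * indicator D x) \<partial>lborel)"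
      using F_fin
    proof (intro nn_integral_mono_AE, eventually_elim)
      case (elim x)
      then show ?case using wle[of x] c f0[of x]
        by (auto split: split_indicator simp: F_eq ennreal_mult[symmetric] intro!: ennreal_leI)
    qed
    also have "\<dots> = ennreal c * ennreal g" unfolding g_eq by (intro nn_integral_cmult) measurable
    finally show ?thesis using c g0 by (simp add: ennreal_mult[symmetric] ennreal_le_iff)
  qed
  have "(LINT x:D|lborel. (h x)\<^sup>2) \<le> (\<rho> powr (2 * s) / \<kappa>) * g"
    using ints[of D] large pos by (intro int_le) auto
  then show "(LINT x:D|lborel. (u x - m)\<^sup>2) \<le> \<rho> powr (2 * s) * g / \<kappa>" by (simp add: h_def)
  define C where "C = (2 / \<kappa> + 4 * \<kappa> powr (- 2 / q)) powr (q / 2)"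
  have "A powr (2 / q) \<le> C * g"
  proof (cases "A = 0")
    case True then show ?thesis using g0 by (simp add: C_def)
  next
    case False
    then have A: "A > 0" using A0 by simp
    have "(LINT x:D|lborel. \<bar>h x\<bar> powr q) \<le> (C * A powr (2 * s / n)) * g"
    proof (rule int_le)
      fix x assume x: "x \<in> D" and fin: "F x < \<infinity>"
      show "\<bar>h x\<bar> powr q \<le> (C * A powr (2 * s / n)) * f x"
        unfolding C_def
        by (rule sobolev_scale_choice[OF s q pos A f0 at_scale[OF x fin] large[OF x fin]])
    qed (use ints(4)[of D] in \<open>auto simp: C_def\<close>)
    then have "A \<le> (C * A powr (2 * s / n)) * g" by (simp add: A_def)
    \<comment> \<open>Since 2s/n = 1 - 2/q, the division leaves exactly A^(2/q).\<close>
    then have "A / A powr (2 * s / n) \<le> C * g" using A by (simp add: pos_divide_le_eq mult_ac)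
    moreover have "A powr (2 / q) = A / A powr (2 * s / n)"
    proof -
      have "2 / q = 1 - 2 * s / n" using s by (simp add: q field_simps)
      then show ?thesis using A by (simp only: powr_diff) simp
    qed
    ultimately show ?thesis by simp
  qed
  then show "(LINT x:D|lborel. \<bar>u x - m\<bar> powr q) powr (2 / q)
           \<le> (2 / \<kappa> + 4 * \<kappa> powr (- 2 / q)) powr (q / 2) * g"
    by (simp add: A_def C_def h_def)
qed

text \<open>The factor of g delivered by \<open>sobolev_combine\<close>, with C the constant of the
  Hedberg estimate. Neither \<rho> nor V occurs in it.\<close>

definition sob_const :: "real \<Rightarrow> real" where
  "sob_const C1 = C1 / (\<kappa> * \<kappa> powr (2 * s / n)) + C1 powr (2 / q) * (2 / \<kappa> + 4 * \<kappa> powr (- 2 / q)) powr (q / 2)"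

lemma sob_const_nonneg: "C1 > 0 \<Longrightarrow> sob_const C1 \<ge> 0"
  using pos by (simp add: sob_const_def)

text \<open>The expansion is integrated around the mean m, and the two error integrals are those
  bounded by \<open>sobolev_poincare_bounded\<close>. \<open>C1\<close> enters as a hypothesis, so
  that one choice serves all dilates.\<close>

lemma sobolev_bounded:
  assumes u [measurable]: "u \<in> borel_measurable borel" and bd: "\<And>x. \<bar>u x\<bar> \<le> B"
    and G: "(\<integral>\<^sup>+x\<in>D. nonlocal_density s D u x \<partial>lborel) < \<infinity>"
    and C1: "C1 > 0" "\<And>m h. \<bar>m + h\<bar> powr q \<le>
      \<bar>m\<bar> powr q + q * \<bar>m\<bar> powr (q - 2) * m * h + C1 * (\<bar>m\<bar> powr (q - 2) * h\<^sup>2 + \<bar>h\<bar> powr q)"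
  shows "(\<integral>\<^sup>+x\<in>D. ennreal (\<bar>u x\<bar> powr q) \<partial>lborel) \<le> ennreal ((V powr (- 2 * s / n) * (LINT x:D|lborel. (u x)\<^sup>2)
      + sob_const C1 * enn2real (\<integral>\<^sup>+x\<in>D. nonlocal_density s D u x \<partial>lborel)) powr (q / 2))"
proof -
  define g where "g = enn2real (\<integral>\<^sup>+x\<in>D. nonlocal_density s D u x \<partial>lborel)"
  define m where "m = (LINT x:D|lborel. u x) / V"
  define h where "h x = u x - m" for x
  define A where "A = (LINT x:D|lborel. \<bar>h x\<bar> powr q)"
  define C where "C = (2 / \<kappa> + 4 * \<kappa> powr (- 2 / q)) powr (q / 2)"
  have g0: "g \<ge> 0" by (simp add: g_def)
  have A: "A powr (2 / q) \<le> C * g" and H2: "(LINT x:D|lborel. (h x)\<^sup>2) \<le> \<rho> powr (2 * s) * g / \<kappa>"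
    using sobolev_poincare_bounded[OF u bd G] by (auto simp: A_def C_def g_def h_def m_def)
  have [measurable]: "h \<in> borel_measurable borel" unfolding h_def by measurable
  have h_bd: "\<bar>h x\<bar> \<le> B + \<bar>m\<bar>" for x using bd[of x] by (simp add: h_def)
  have sq_bd: "\<bar>(w::real)\<^sup>2\<bar> \<le> b\<^sup>2" if "\<bar>w\<bar> \<le> b" for w b
    using power_mono[of "\<bar>w\<bar>" b 2] that by simp
  have pw_bd: "\<bar>\<bar>w\<bar> powr q\<bar> \<le> b powr q" if "\<bar>w\<bar> \<le> b" for w b :: real
    using that q_gt_2 by (simp add: powr_mono2)
  note bi = set_integrable_bounded[OF _ _ D(1) finite_emeasure[OF order_refl]]
  have int_u: "set_integrable lborel D u" by (rule bi[OF _ bd]) measurable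
  have int_h: "set_integrable lborel D h" by (rule bi[OF _ h_bd]) measurable
  have int_u2: "set_integrable lborel D (\<lambda>x. (u x)\<^sup>2)" by (rule bi[OF _ sq_bd[OF bd]]) measurable
  have int_h2: "set_integrable lborel D (\<lambda>x. (h x)\<^sup>2)" by (rule bi[OF _ sq_bd[OF h_bd]]) measurable
  have int_uq: "set_integrable lborel D (\<lambda>x. \<bar>u x\<bar> powr q)" by (rule bi[OF _ pw_bd[OF bd]]) measurable
  have int_hq: "set_integrable lborel D (\<lambda>x. \<bar>h x\<bar> powr q)" by (rule bi[OF _ pw_bd[OF h_bd]]) measurable
  have int_c: "set_integrable lborel D (\<lambda>x. c)" for c :: real by (rule bi[OF _ order_refl]) measurable
  have const: "(LINT y:D|lborel. c) = V * c" for c :: real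
    using finite_emeasure[of D] by (simp add: set_lebesgue_integral_def less_top)
  have u_mean: "(LINT y:D|lborel. u y) = V * m" using V_pos by (simp add: m_def)
  have h_mean: "(LINT y:D|lborel. h y) = 0"
    unfolding h_def using int_u int_c by (simp add: set_integral_diff const u_mean)
  have A0: "A \<ge> 0" unfolding A_def set_lebesgue_integral_def by (intro Bochner_Integration.integral_nonneg) simp
  have "(LINT x:D|lborel. \<bar>u x\<bar> powr q) \<le>
    (LINT x:D|lborel. \<bar>m\<bar> powr q + (q * \<bar>m\<bar> powr (q - 2) * m * h x + (C1 * \<bar>m\<bar> powr (q - 2) * (h x)\<^sup>2 + C1 * \<bar>h x\<bar> powr q)))"
  proof (rule set_integral_mono)
    fix x
    show "\<bar>u x\<bar> powr q \<le> \<bar>m\<bar> powr q + (q * \<bar>m\<bar> powr (q - 2) * m * h x + (C1 * \<bar>m\<bar> powr (q - 2) * (h x)\<^sup>2 + C1 * \<bar>h x\<bar> powr q))"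
      using C1(2)[of m "h x"] by (simp add: h_def algebra_simps)
  qed (use int_uq int_h int_h2 int_hq int_c in \<open>auto intro!: set_integral_add\<close>)
  also have "\<dots> = V * \<bar>m\<bar> powr q + C1 * (\<bar>m\<bar> powr (q - 2) * (LINT x:D|lborel. (h x)\<^sup>2) + A)"
    using int_h int_h2 int_hq int_c
    by (simp add: set_integral_add const h_mean set_integral_mult_right A_def algebra_simps)
  also have "\<dots> \<le> V * \<bar>m\<bar> powr q + C1 * (\<bar>m\<bar> powr (q - 2) * (\<rho> powr (2 * s) * g / \<kappa>) + A)"
    using C1(1) H2 by (intro add_left_mono mult_left_mono add_right_mono) auto
  also have "\<dots> \<le> (V powr (2 / q) * m\<^sup>2 + (C1 / (\<kappa> * \<kappa> powr (2 * s / n)) + C1 powr (2 / q) * C) * g) powr (q / 2)"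
  proof (rule sobolev_combine[OF s q pos A0 g0 _ C1(1) V_ge A])
    have "2 / \<kappa> + 4 * \<kappa> powr (- 2 / q) > 0" using pos by (simp add: add_pos_nonneg)
    then show "C > 0" unfolding C_def by simp
  qed
  also have "\<dots> = (V powr (2 / q) * m\<^sup>2 + sob_const C1 * g) powr (q / 2)"
    by (simp add: sob_const_def C_def)
  also have "\<dots> \<le> (V powr (- 2 * s / n) * (LINT x:D|lborel. (u x)\<^sup>2) + sob_const C1 * g) powr (q / 2)"
  proof (rule powr_mono2)
    \<comment> \<open>Jensen's inequality for the square, through the tangent 2 m u - m^2 \<le> u^2
      at the mean.\<close>
    have "V * m\<^sup>2 = (LINT x:D|lborel. 2 * m * u x - m\<^sup>2)"
      using int_u int_c by (simp add: set_integral_diff set_integral_mult_right const u_mean power2_eq_square)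
    also have "\<dots> \<le> (LINT x:D|lborel. (u x)\<^sup>2)"
    proof (rule set_integral_mono)
      fix x show "2 * m * u x - m\<^sup>2 \<le> (u x)\<^sup>2"
        using zero_le_power2[of "u x - m"] by (simp add: power2_eq_square algebra_simps)
    qed (use int_u int_u2 int_c in \<open>auto intro!: set_integral_diff\<close>)
    finally have "V powr (- 2 * s / n) * (V * m\<^sup>2) \<le> V powr (- 2 * s / n) * (LINT x:D|lborel. (u x)\<^sup>2)"
      by (intro mult_left_mono) auto
    moreover have "V powr (2 / q) = V powr (- 2 * s / n) * V"
    proof -
      have "2 / q = - 2 * s / n + 1" using s by (simp add: q field_simps)
      then show ?thesis using V_pos by (simp only: powr_add) simp
    qed
    ultimately show "V powr (2 / q) * m\<^sup>2 + sob_const C1 * g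
        \<le> V powr (- 2 * s / n) * (LINT x:D|lborel. (u x)\<^sup>2) + sob_const C1 * g"
      by (simp add: mult_ac)
    show "0 \<le> V powr (2 / q) * m\<^sup>2 + sob_const C1 * g"
      using sob_const_nonneg[OF C1(1)] g0 by simp
  qed (use q_gt_2 in simp)
  finally show ?thesis
    unfolding g_def[symmetric] by (subst set_nn_integral_eq_set_integral_nonneg[OF int_uq]) (auto intro: ennreal_leI)
qed

text \<open>Truncating u at height k increases neither differences nor absolute values, so the
  bounded case holds with the right side belonging to u; monotone convergence then removes k.
  Finiteness of the left side is part of the conclusion.\<close>

lemma sobolev_inequality:
  assumes u [measurable]: "u \<in> borel_measurable borel"
    and u2: "set_integrable lborel D (\<lambda>x. (u x)\<^sup>2)"
    and G: "(\<integral>\<^sup>+x\<in>D. nonlocal_density s D u x \<partial>lborel) < \<infinity>"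
    and C1: "C1 > 0" "\<And>m h. \<bar>m + h\<bar> powr q \<le>
      \<bar>m\<bar> powr q + q * \<bar>m\<bar> powr (q - 2) * m * h + C1 * (\<bar>m\<bar> powr (q - 2) * h\<^sup>2 + \<bar>h\<bar> powr q)"
  shows "(\<integral>\<^sup>+x\<in>D. ennreal (\<bar>u x\<bar> powr q) \<partial>lborel) \<le> ennreal ((V powr (- 2 * s / n) * (LINT x:D|lborel. (u x)\<^sup>2)
      + sob_const C1 * enn2real (\<integral>\<^sup>+x\<in>D. nonlocal_density s D u x \<partial>lborel)) powr (q / 2))"
    (is "_ \<le> ennreal (?R powr (q / 2))")
proof -
  define v where "v k x = max (- real k) (min (real k) (u x))" for k :: nat and x
  have [measurable]: "v k \<in> borel_measurable borel" for k unfolding v_def by measurable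
  have v_bd: "\<bar>v k x\<bar> \<le> real k" for k x by (auto simp: v_def)
  have v_abs: "\<bar>v k x\<bar> = min (real k) \<bar>u x\<bar>" for k x by (auto simp: v_def)
  have v_diff: "\<bar>v k x - v k y\<bar> \<le> \<bar>u x - u y\<bar>" for k x y by (auto simp: v_def)
  have dens: "nonlocal_density s D (v k) x \<le> nonlocal_density s D u x" for k x
  proof -
    have "(v k x - v k y)\<^sup>2 / norm (x - y) powr (n + 2 * s) \<le> (u x - u y)\<^sup>2 / norm (x - y) powr (n + 2 * s)" for y
      using v_diff[of k x y] by (intro divide_right_mono) (auto simp: abs_le_square_iff)
    then show ?thesis
      unfolding nonlocal_density_def n[symmetric]
      by (intro nn_integral_mono mult_right_mono ennreal_leI) auto
  qed
  have Gk: "(\<integral>\<^sup>+x\<in>D. nonlocal_density s D (v k) x \<partial>lborel) \<le> (\<integral>\<^sup>+x\<in>D. nonlocal_density s D u x \<partial>lborel)" for k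
    using dens by (intro nn_integral_mono mult_right_mono) auto
  have vk: "(\<integral>\<^sup>+x\<in>D. ennreal (\<bar>v k x\<bar> powr q) \<partial>lborel) \<le> ennreal (?R powr (q / 2))" for k
  proof -
    have "set_integrable lborel D (\<lambda>x. (v k x)\<^sup>2)"
    proof (rule set_integrable_bound[OF u2])
      show "AE x in lborel. x \<in> D \<longrightarrow> norm ((v k x)\<^sup>2) \<le> norm ((u x)\<^sup>2)"
        using v_abs by (auto intro!: AE_I2 simp: abs_le_square_iff[symmetric])
    qed (simp add: set_borel_measurable_def)
    then have L2: "(LINT x:D|lborel. (v k x)\<^sup>2) \<le> (LINT x:D|lborel. (u x)\<^sup>2)"
      using v_abs by (intro set_integral_mono u2) (auto simp: abs_le_square_iff[symmetric])
    have L2_0: "0 \<le> (LINT x:D|lborel. (v k x)\<^sup>2)"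
      unfolding set_lebesgue_integral_def by (intro Bochner_Integration.integral_nonneg) simp
    have "(\<integral>\<^sup>+x\<in>D. ennreal (\<bar>v k x\<bar> powr q) \<partial>lborel) \<le> ennreal ((V powr (- 2 * s / n) * (LINT x:D|lborel. (v k x)\<^sup>2)
      + sob_const C1 * enn2real (\<integral>\<^sup>+x\<in>D. nonlocal_density s D (v k) x \<partial>lborel)) powr (q / 2))"
      using Gk[of k] G by (intro sobolev_bounded[OF _ v_bd _ C1]) auto
    also have "\<dots> \<le> ennreal (?R powr (q / 2))"
      using Gk[of k] G L2 L2_0 sob_const_nonneg[OF C1(1)] q_gt_2
      by (intro ennreal_leI powr_mono2 add_mono mult_left_mono enn2real_mono) (auto intro!: add_nonneg_nonneg mult_nonneg_nonneg)
    finally show ?thesis .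
  qed
  have "(\<lambda>k. \<integral>\<^sup>+x\<in>D. ennreal (\<bar>v k x\<bar> powr q) \<partial>lborel) \<longlonglongrightarrow> (\<integral>\<^sup>+x\<in>D. ennreal (\<bar>u x\<bar> powr q) \<partial>lborel)"
  proof (rule nn_integral_LIMSEQ)
    show "incseq (\<lambda>k x. ennreal (\<bar>v k x\<bar> powr q) * indicator D x)"
      unfolding v_abs incseq_def le_fun_def using q_gt_2
      by (intro allI impI mult_right_mono ennreal_leI powr_mono2) auto
    fix x
    obtain N :: nat where N: "\<bar>u x\<bar> \<le> real N" using real_arch_simple by blast
    show "(\<lambda>k. ennreal (\<bar>v k x\<bar> powr q) * indicator D x) \<longlonglongrightarrow> ennreal (\<bar>u x\<bar> powr q) * indicator D x"
    proof (rule tendsto_eventually, rule eventually_sequentiallyI)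
      fix k assume "N \<le> k"
      then have "\<bar>v k x\<bar> = \<bar>u x\<bar>" using N unfolding v_abs by linarith
      then show "ennreal (\<bar>v k x\<bar> powr q) * indicator D x = ennreal (\<bar>u x\<bar> powr q) * indicator D x" by simp
    qed
  qed measurable
  then show ?thesis by (rule LIMSEQ_le_const2) (use vk in blast)
qed

end

section \<open>Positivity of the constants\<close>

text \<open>Takes the place of integration in polar coordinates: a radial weight is dominated by a
  series of multiples of ball indicators.\<close>

lemma nn_integral_dyadic_sum_finite:
  fixes c r :: "nat \<Rightarrow> real"
  assumes r: "\<And>k. r k > 0" and c: "\<And>k. c k \<ge> 0"
    and sm: "summable (\<lambda>k. c k * r k ^ DIM('a::euclidean_space))"
  shows "(\<integral>\<^sup>+z. (\<Sum>k. ennreal (c k) * indicator (ball (0::'a) (r k)) z) \<partial>lborel) < \<infinity>"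
proof -
  define w where "w = unit_ball_vol (DIM('a))"
  have w: "w \<ge> 0" by (simp add: w_def)
  have "(\<integral>\<^sup>+z. (\<Sum>k. ennreal (c k) * indicator (ball (0::'a) (r k)) z) \<partial>lborel)
      = (\<Sum>k. \<integral>\<^sup>+z. ennreal (c k) * indicator (ball (0::'a) (r k)) z \<partial>lborel)"
    by (intro nn_integral_suminf borel_measurable_times_ennreal borel_measurable_indicator) auto
  also have "\<dots> = (\<Sum>k. ennreal (w * (c k * r k ^ DIM('a))))"
  proof (intro arg_cong[of _ _ suminf] ext)
    fix k
    have "(\<integral>\<^sup>+z. ennreal (c k) * indicator (ball (0::'a) (r k)) z \<partial>lborel) = ennreal (c k) * emeasure lborel (ball (0::'a) (r k))"
      by (rule nn_integral_cmult_indicator) simp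
    also have "\<dots> = ennreal (c k) * ennreal (w * r k ^ DIM('a))"
      using r[of k] by (simp add: emeasure_ball w_def)
    also have "\<dots> = ennreal (w * (c k * r k ^ DIM('a)))"
      using c[of k] r[of k] w by (simp add: ennreal_mult[symmetric] mult_ac)
    finally show "(\<integral>\<^sup>+z. ennreal (c k) * indicator (ball (0::'a) (r k)) z \<partial>lborel) = ennreal (w * (c k * r k ^ DIM('a)))" .
  qed
  also have "\<dots> = ennreal (\<Sum>k. w * (c k * r k ^ DIM('a)))"
    using w c r sm by (intro suminf_ennreal_eq summable_sums summable_mult) (auto intro!: mult_nonneg_nonneg simp: less_imp_le)
  finally show ?thesis by simp
qed

lemma ennreal_term_le_suminf: "(f k :: ennreal) \<le> (\<Sum>k. f k)"
  using sum_le_suminf[of f "{k}"] by simp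

lemma ex_dyadic_ge_one:
  fixes x :: real assumes "x \<ge> 1"
  obtains k :: nat where "2 ^ k \<le> x" "x < 2 ^ Suc k"
proof -
  have ex: "\<exists>k. x < 2 ^ k" using real_arch_pow[of 2 x] by simp
  define j where "j = (LEAST k. x < 2 ^ k)"
  have j: "x < 2 ^ j" unfolding j_def using ex by (rule LeastI_ex)
  have "j \<noteq> 0" using j assms by (intro notI) simp
  then obtain k where k: "j = Suc k" using not0_implies_Suc by blast
  have "\<not> x < 2 ^ k" using not_less_Least[of k "\<lambda>k. x < 2 ^ k"] k unfolding j_def by simp
  then show thesis using that[of k] j k by simp
qed

text \<open>Common majorant of two integrands: the one defining c_{n,s}, up to a factor 2, and the
  Gagliardo kernel of \<open>tent\<close>, with z = x - y.\<close>

definition gag_weight :: "real \<Rightarrow> 'a::euclidean_space \<Rightarrow> real" where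
  "gag_weight s z = min 1 ((norm z)\<^sup>2) / norm z powr (real DIM('a) + 2 * s)"

lemma gag_weight_nonneg: "gag_weight s z \<ge> 0"
  by (simp add: gag_weight_def)

lemma gag_weight_measurable [measurable]: "gag_weight s \<in> borel_measurable borel"
  unfolding gag_weight_def by measurable

text \<open>On the shell |z| ~ 2^k the weight is of order 2^(-k(n+2s)) and the volume of order
  2^(kn); the sum over the outer shells converges as s > 0. On |z| ~ 2^(-k) the numerator |z|^2
  leaves terms of order 2^(-k(2-2s)), and that sum converges as s < 1.\<close>

lemma gag_weight_finite:
  fixes s :: real
  assumes s: "0 < s" "s < 1"
  shows "(\<integral>\<^sup>+z. ennreal (gag_weight s z) \<partial>(lborel :: 'a::euclidean_space measure)) < \<infinity>"
proof -
  define n where "n = real DIM('a)"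
  have n: "n \<ge> 1" by (simp add: n_def Suc_leI)
  define K where "K z = min 1 ((norm z)\<^sup>2) / norm z powr (n + 2 * s)" for z :: 'a
  define c1 where "c1 k = (1/2) powr (real k * (n + 2 * s))" for k :: nat
  \<comment> \<open>On the shell 2^(-k-1) < |z| \<le> 2^(-k) the factors |z|^(2-2s) and |z|^(-n) are
    bounded at opposite ends, which produces the extra 2^n.\<close>
  define c2 where "c2 k = 2 powr n * (2 powr (real k * n) * (1/2) powr (real k * (2 - 2 * s)))" for k :: nat
  define S1 where "S1 z = (\<Sum>k. ennreal (c1 k) * indicator (ball (0::'a) (2 ^ Suc k)) z)" for z
  \<comment> \<open>The radius is doubled because the balls are open and |z| = 2^(-k) can
    occur.\<close>
  define S2 where "S2 z = (\<Sum>k. ennreal (c2 k) * indicator (ball (0::'a) (2 * (1/2) ^ k)) z)" for z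
  have pw: "x ^ DIM('a) = x powr n" if "x > 0" for x :: real
    using that by (simp add: n_def powr_realpow)
  have gs: "summable (\<lambda>k. (x powr (real k * a)))" if "0 < x" "x < 1" "a > 0" for x a :: real
  proof -
    have "x powr a < 1" using that powr_less_mono2[of a x 1] by simp
    then have "summable (\<lambda>k. (x powr a) ^ k)" using that by (intro summable_geometric) auto
    moreover have "(x powr a) ^ k = x powr (real k * a)" for k
      using that by (simp add: powr_realpow[symmetric] powr_powr mult.commute)
    ultimately show ?thesis by simp
  qed
  have half: "(1/2) powr x = 2 powr (- x)" for x :: real
    by (simp add: powr_minus_divide powr_divide)
  have f1: "(\<integral>\<^sup>+z. S1 z \<partial>lborel) < \<infinity>"
    unfolding S1_def
  proof (rule nn_integral_dyadic_sum_finite)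
    have "c1 k * (2 ^ Suc k) ^ DIM('a) = 2 powr n * (1/2) powr (real k * (2 * s))" for k
    proof -
      have "(2 ^ Suc k) ^ DIM('a) = (2 powr (real k + 1)) powr n"
        using pw[of "2 ^ Suc k"] powr_realpow[of 2 "Suc k"] by (simp add: add.commute)
      then show ?thesis
        by (simp add: c1_def half powr_powr powr_add[symmetric] algebra_simps)
    qed
    then show "summable (\<lambda>k. c1 k * (2 ^ Suc k) ^ DIM('a))"
      using gs[of "1/2" "2 * s"] s by (simp add: summable_mult)
  qed (auto simp: c1_def)
  have f2: "(\<integral>\<^sup>+z. S2 z \<partial>lborel) < \<infinity>"
    unfolding S2_def
  proof (rule nn_integral_dyadic_sum_finite)
    have "c2 k * (2 * (1/2) ^ k) ^ DIM('a) = 2 powr n * 2 powr n * (1/2) powr (real k * (2 - 2 * s))" for k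
    proof -
      have "2 * (1/2) ^ k = (2::real) powr (1 - real k)"
        by (simp add: powr_diff powr_realpow power_divide)
      then have "(2 * (1/2) ^ k) ^ DIM('a) = (2 powr (1 - real k)) powr n"
        using pw[of "2 * (1/2) ^ k"] by simp
      then show ?thesis
        by (simp add: c2_def half powr_powr powr_add[symmetric] algebra_simps)
    qed
    then show "summable (\<lambda>k. c2 k * (2 * (1/2) ^ k) ^ DIM('a))"
      using gs[of "1/2" "2 - 2 * s"] s by (simp add: summable_mult)
  qed (auto simp: c2_def)
  have le: "ennreal (K z) \<le> S1 z + S2 z" for z
  proof (cases "norm z \<ge> 1")
    case True
    then obtain k :: nat where k: "2 ^ k \<le> norm z" "norm z < 2 ^ Suc k" by (rule ex_dyadic_ge_one)
    have "(2 ^ k) powr (n + 2 * s) \<le> norm z powr (n + 2 * s)" using k n s by (intro powr_mono2) auto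
    then have "K z \<le> 1 / (2 ^ k) powr (n + 2 * s)"
      unfolding K_def by (intro frac_le) auto
    also have "\<dots> = c1 k" by (simp add: c1_def powr_realpow[symmetric] powr_powr powr_divide)
    finally have "ennreal (K z) \<le> ennreal (c1 k) * indicator (ball (0::'a) (2 ^ Suc k)) z"
      using k by (simp add: ennreal_leI)
    also have "\<dots> \<le> S1 z" unfolding S1_def by (rule ennreal_term_le_suminf)
    finally show ?thesis by (simp add: add_increasing2)
  next
    case False
    show ?thesis
    proof (cases "z = 0")
      case True then show ?thesis by (simp add: K_def)
    next
      case z: False
      then have "1 / norm z \<ge> 1" using False by simp
      then obtain k :: nat where k: "2 ^ k \<le> 1 / norm z" "1 / norm z < 2 ^ Suc k" by (rule ex_dyadic_ge_one)
      have k': "norm z \<le> (1/2) ^ k" "(1/2) ^ Suc k < norm z"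
        using k z by (auto simp: field_simps power_divide)
      have "K z \<le> (norm z)\<^sup>2 / norm z powr (n + 2 * s)" unfolding K_def by (intro divide_right_mono) auto
      also have "\<dots> = norm z powr (2 - 2 * s) * (1 / norm z) powr n"
        using z by (simp add: powr_diff powr_add powr_divide powr_numeral field_simps)
      also have "\<dots> \<le> ((1/2) ^ k) powr (2 - 2 * s) * (2 ^ Suc k) powr n"
        using k k' s n z by (intro mult_mono powr_mono2) auto
      also have "\<dots> = c2 k"
        by (simp add: c2_def powr_realpow[symmetric] powr_powr powr_mult powr_add algebra_simps)
      finally have "K z \<le> c2 k" .
      moreover have "norm z < 2 * (1/2) ^ k" using k'(1) zero_less_power[of "1/2::real" k] by linarith
      ultimately have "ennreal (K z) \<le> ennreal (c2 k) * indicator (ball (0::'a) (2 * (1/2) ^ k)) z"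
        by (simp add: ennreal_leI)
      also have "\<dots> \<le> S2 z" unfolding S2_def by (rule ennreal_term_le_suminf)
      finally show ?thesis by (simp add: add_increasing)
    qed
  qed
  have "(\<integral>\<^sup>+z. ennreal (K z) \<partial>lborel) \<le> (\<integral>\<^sup>+z. S1 z + S2 z \<partial>lborel)"
    by (intro nn_integral_mono le)
  also have "\<dots> = (\<integral>\<^sup>+z. S1 z \<partial>lborel) + (\<integral>\<^sup>+z. S2 z \<partial>lborel)"
    unfolding S1_def S2_def
    by (intro nn_integral_add borel_measurable_suminf_order borel_measurable_times_ennreal borel_measurable_indicator) auto
  also have "\<dots> < \<infinity>" using f1 f2 by simp
  finally show ?thesis by (simp add: gag_weight_def K_def n_def)
qed

lemma one_minus_cos_bounds: "1 - cos t \<le> 2 * min 1 (t\<^sup>2)" for t :: real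
proof -
  have "1 - cos t = 2 * (sin (t / 2))\<^sup>2" using cos_double_sin[of "t / 2"] by simp
  also have "(sin (t / 2))\<^sup>2 \<le> (t / 2)\<^sup>2" using abs_sin_x_le_abs_x[of "t / 2"] abs_le_square_iff by blast
  finally have "1 - cos t \<le> 2 * t\<^sup>2" by (simp add: power2_eq_square) (use zero_le_square[of t] in linarith)
  then show ?thesis using cos_ge_minus_one[of t] by (auto simp: min_def)
qed

lemma AE_not_in_open_imp_empty:
  fixes U :: "'a::euclidean_space set"
  assumes "AE x in lborel. x \<notin> U" "open U" shows "U = {}"
proof -
  have "AE x in lebesgue. x \<notin> U" using assms(1) by (simp add: AE_completion_iff)
  then have "U \<in> null_sets lebesgue"
    using assms(2) by (subst AE_iff_null_sets) auto
  then show ?thesis using assms(2) open_not_negligible[of U] by (auto simp: negligible_iff_null_sets)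
qed

text \<open>A Bochner integral of a function that is not integrable is 0, and so is the inverse of
  0. Positivity therefore takes two facts: the integrand is integrable, and its integral does not
  vanish.\<close>

lemma frac_const_pos:
  assumes s: "0 < s" "s < 1"
  shows "frac_const TYPE('n::{finite,wellorder}) s > 0"
proof -
  define i where "i = (Min UNIV :: 'n)"
  define I where "I \<theta> = (1 - cos (\<theta> $ i)) / norm \<theta> powr (real CARD('n) + 2 * s)" for \<theta> :: "real^'n::_"
  have I0: "I \<theta> \<ge> 0" for \<theta> by (simp add: I_def)
  have I_meas [measurable]: "I \<in> borel_measurable borel" unfolding I_def by measurable
  have "I \<theta> \<le> 2 * gag_weight s \<theta>" for \<theta>
  proof -
    have "(\<theta> $ i)\<^sup>2 \<le> (norm \<theta>)\<^sup>2" using component_le_norm_cart[of \<theta> i] by (simp add: abs_le_square_iff[symmetric])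
    then have "1 - cos (\<theta> $ i) \<le> 2 * min 1 ((norm \<theta>)\<^sup>2)" using one_minus_cos_bounds[of "\<theta> $ i"] by (auto simp: min_def split: if_splits)
    then have "I \<theta> \<le> (2 * min 1 ((norm \<theta>)\<^sup>2)) / norm \<theta> powr (real CARD('n) + 2 * s)"
      unfolding I_def by (rule divide_right_mono) simp
    then show ?thesis by (simp add: gag_weight_def)
  qed
  then have "(\<integral>\<^sup>+\<theta>. ennreal (I \<theta>) \<partial>lborel) \<le> (\<integral>\<^sup>+\<theta>. 2 * ennreal (gag_weight s (\<theta> :: real^'n::_)) \<partial>lborel)"
    by (intro nn_integral_mono) (simp add: ennreal_leI ennreal_mult[symmetric] gag_weight_nonneg flip: ennreal_numeral)
  also have "\<dots> = 2 * (\<integral>\<^sup>+\<theta>. ennreal (gag_weight s (\<theta> :: real^'n::_)) \<partial>lborel)"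
    by (rule nn_integral_cmult) simp
  also have "\<dots> < \<infinity>" using gag_weight_finite[OF s, where 'a="real^'n::_"] by (simp add: ennreal_mult_less_top)
  finally have int: "integrable lborel I"
    by (intro integrableI_nonneg) (auto simp: I0)
  have "integral\<^sup>L lborel I \<noteq> 0"
  proof
    assume "integral\<^sup>L lborel I = 0"
    then have "AE \<theta> in lborel. I \<theta> = 0"
      using integral_nonneg_eq_0_iff_AE[OF int] I0 by simp
    \<comment> \<open>On this open slab the cosine is below 1, so the integrand is positive
      there.\<close>
    moreover define U where "U = {\<theta> :: real^'n::_. 0 < \<theta> $ i \<and> \<theta> $ i < 1}"
    have "\<theta> \<notin> U" if "I \<theta> = 0" for \<theta>
    proof
      assume "\<theta> \<in> U"
      then have "0 < \<theta> $ i" "\<theta> $ i \<le> pi" "\<theta> \<noteq> 0" using pi_gt3 by (auto simp: U_def)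
      moreover have "cos (\<theta> $ i) < cos 0" using cos_monotone_0_pi[of 0 "\<theta> $ i"] calculation by simp
      ultimately show False using that by (simp add: I_def)
    qed
    ultimately have "AE \<theta> in lborel. \<theta> \<notin> U" by auto
    moreover have "open U"
      unfolding U_def by (intro open_Collect_conj open_Collect_less continuous_intros)
    ultimately have "U = {}" by (rule AE_not_in_open_imp_empty)
    moreover have "(\<chi> i. 1/2) \<in> U" by (simp add: U_def)
    ultimately show False by blast
  qed
  moreover have "integral\<^sup>L lborel I \<ge> 0" by (simp add: I0)
  ultimately have "integral\<^sup>L lborel I > 0" by simp
  moreover have "frac_const TYPE('n) s = inverse (integral\<^sup>L lborel I)"
    unfolding frac_const_def I_def[symmetric] i_def[symmetric] by (simp add: integral_completion)
  ultimately show ?thesis by simp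
qed

lemma frac_energy_nonneg:
  assumes "frac_const TYPE('n::{finite,wellorder}) s \<ge> 0"
  shows "frac_energy s D (u :: real^'n::_ \<Rightarrow> real) \<ge> 0"
  unfolding frac_energy_def set_lebesgue_integral_def
  using assms by (intro mult_nonneg_nonneg integral_nonneg)
    (auto simp: gagliardo_kernel_def split: prod.split)

section \<open>A test function of finite energy\<close>

definition tent :: "'a::real_normed_vector \<Rightarrow> real" where
  "tent x = max 0 (1 - norm x)"

text \<open>\<open>tent\<close> is 1-Lipschitz with values in [0, 1].\<close>

lemma tent_diff_sq_le: "(tent x - tent y)\<^sup>2 \<le> min 1 ((norm (x - y))\<^sup>2)"
proof -
  have "\<bar>tent x - tent y\<bar> \<le> 1" using norm_ge_zero[of x] norm_ge_zero[of y] unfolding tent_def by linarith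
  moreover have "\<bar>tent x - tent y\<bar> \<le> norm (x - y)"
    using norm_triangle_ineq3[of x y] by (auto simp: tent_def)
  ultimately show ?thesis
    using power_mono[of "\<bar>tent x - tent y\<bar>" 1 2] power_mono[of "\<bar>tent x - tent y\<bar>" "norm (x - y)" 2] by simp
qed

lemma tent_measurable [measurable]: "(tent :: 'a::euclidean_space \<Rightarrow> real) \<in> borel_measurable borel"
  unfolding tent_def by measurable

lemma nn_integral_gag_weight_shift:
  "(\<integral>\<^sup>+y. ennreal (gag_weight s (x - y)) \<partial>lborel) = (\<integral>\<^sup>+z. ennreal (gag_weight s (z :: 'a)) \<partial>lborel)"
  for x :: "'a::euclidean_space"
proof -
  have "(\<integral>\<^sup>+z. ennreal (gag_weight s z) \<partial>(lborel :: 'a measure)) = (\<integral>\<^sup>+z. ennreal (gag_weight s z) \<partial>distr lborel borel ((+) (- x)))"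
    by (simp add: lborel_distr_plus)
  also have "\<dots> = (\<integral>\<^sup>+y. ennreal (gag_weight s (- x + y)) \<partial>lborel)"
    by (rule nn_integral_distr) auto
  also have "\<dots> = (\<integral>\<^sup>+y. ennreal (gag_weight s (x - y)) \<partial>lborel)"
  proof -
    have "norm (- x + y) = norm (x - y)" for y by (simp add: norm_minus_commute)
    then show ?thesis by (simp add: gag_weight_def)
  qed
  finally show ?thesis by simp
qed

lemma gagliardo_kernel_nonneg: "gagliardo_kernel s u z \<ge> 0"
  by (cases z) (simp add: gagliardo_kernel_def)

lemma gagliardo_kernel_measurable:
  fixes u :: "real^'n::{finite,wellorder} \<Rightarrow> real"
  assumes [measurable]: "u \<in> borel_measurable borel"
  shows "gagliardo_kernel s u \<in> borel_measurable borel"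
proof -
  have "gagliardo_kernel s u \<in> borel_measurable (borel \<Otimes>\<^sub>M borel)"
    unfolding gagliardo_kernel_def by measurable
  then show ?thesis by (simp add: borel_prod)
qed

text \<open>The increment vanishes unless x or y lies in the unit ball. The kernel is thus at most
  the sum of two copies of the weight, each restricted in one variable to the ball; by Tonelli and
  translation invariance, each integrates to the volume of the ball times the integral of the
  weight.\<close>

lemma tent_kernel_integrable:
  assumes s: "0 < s" "s < 1"
  shows "integrable lborel (gagliardo_kernel s (tent :: real^'n::{finite,wellorder} \<Rightarrow> real))"
proof (rule integrableI_nonneg)
  let ?k = "gagliardo_kernel s (tent :: real^'n::_ \<Rightarrow> real)"
  let ?K = "\<integral>\<^sup>+z. ennreal (gag_weight s (z :: real^'n::_)) \<partial>lborel"
  define B where "B = ball (0 :: real^'n::_) 1"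
  have [measurable]: "B \<in> sets borel" by (simp add: B_def)
  have [measurable]: "?k \<in> borel_measurable borel" by (rule gagliardo_kernel_measurable) simp
  show "?k \<in> borel_measurable lborel" by simp
  define F where "F x y = indicator B x * ennreal (gag_weight s (x - y))" for x y :: "real^'n::_"
  define F' where "F' x y = indicator B y * ennreal (gag_weight s (x - y))" for x y :: "real^'n::_"
  have meas: "(\<lambda>(x, y). F x y) \<in> borel_measurable (lborel \<Otimes>\<^sub>M lborel)"
       "(\<lambda>(x, y). F' x y) \<in> borel_measurable (lborel \<Otimes>\<^sub>M lborel)"
    unfolding F_def F'_def by measurable
  have le: "ennreal (?k (x, y)) \<le> F x y + F' x y" for x y
  proof (cases "x \<in> B \<or> y \<in> B")
    case True
    have "?k (x, y) \<le> gag_weight s (x - y)"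
      unfolding gagliardo_kernel_def gag_weight_def
      using tent_diff_sq_le[of x y] by (simp add: divide_right_mono)
    then have "ennreal (?k (x, y)) \<le> ennreal (gag_weight s (x - y))" by (rule ennreal_leI)
    then show ?thesis using True by (auto simp: F_def F'_def add_increasing add_increasing2 split: split_indicator)
  next
    case False
    then have "tent x = 0" "tent y = 0" by (auto simp: B_def tent_def)
    then show ?thesis by (simp add: gagliardo_kernel_def)
  qed
  have "(\<integral>\<^sup>+z. ennreal (?k z) \<partial>lborel) = (\<integral>\<^sup>+z. ennreal (?k z) \<partial>(lborel \<Otimes>\<^sub>M lborel))"
    by (simp add: lborel_prod)
  also have "\<dots> \<le> (\<integral>\<^sup>+z. (case z of (x, y) \<Rightarrow> F x y) + (case z of (x, y) \<Rightarrow> F' x y) \<partial>(lborel \<Otimes>\<^sub>M lborel))"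
    using le by (intro nn_integral_mono) auto
  also have "\<dots> = (\<integral>\<^sup>+z. (case z of (x, y) \<Rightarrow> F x y) \<partial>(lborel \<Otimes>\<^sub>M lborel)) + (\<integral>\<^sup>+z. (case z of (x, y) \<Rightarrow> F' x y) \<partial>(lborel \<Otimes>\<^sub>M lborel))"
    using meas by (rule nn_integral_add)
  also have "(\<integral>\<^sup>+z. (case z of (x, y) \<Rightarrow> F x y) \<partial>(lborel \<Otimes>\<^sub>M lborel)) = (\<integral>\<^sup>+x. \<integral>\<^sup>+y. F x y \<partial>lborel \<partial>lborel)"
    using lborel.nn_integral_fst[OF meas(1)] by simp
  also have "(\<integral>\<^sup>+z. (case z of (x, y) \<Rightarrow> F' x y) \<partial>(lborel \<Otimes>\<^sub>M lborel)) = (\<integral>\<^sup>+y. \<integral>\<^sup>+x. F' x y \<partial>lborel \<partial>lborel)"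
    using lborel_pair.nn_integral_snd[OF meas(2)] by simp
  also have "(\<lambda>x. \<integral>\<^sup>+y. F x y \<partial>lborel) = (\<lambda>x. indicator B x * ?K)"
    unfolding F_def by (subst nn_integral_cmult) (auto simp: nn_integral_gag_weight_shift)
  also have "(\<lambda>y. \<integral>\<^sup>+x. F' x y \<partial>lborel) = (\<lambda>y. indicator B y * ?K)"
  proof -
    have "gag_weight s (x - y) = gag_weight s (y - x)" for x y :: "real^'n::_"
      by (simp add: gag_weight_def norm_minus_commute)
    then show ?thesis
      unfolding F'_def by (subst nn_integral_cmult) (auto simp: nn_integral_gag_weight_shift)
  qed
  also have "(\<integral>\<^sup>+x. indicator B x * ?K \<partial>lborel) = emeasure lborel B * ?K"
    by (subst nn_integral_multc) auto
  also have "emeasure lborel B * ?K + emeasure lborel B * ?K < \<infinity>"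
    using gag_weight_finite[OF s, where 'a="real^'n::_"] emeasure_lborel_ball_finite[of "0 :: real^'n::_" 1]
    by (simp add: B_def ennreal_mult_less_top less_top)
  finally show "(\<integral>\<^sup>+z. ennreal (?k z) \<partial>lborel) < \<infinity>" .
qed (simp add: gagliardo_kernel_nonneg)

text \<open>
  The supremum of a set of reals that is not bounded above is unspecified, so this needs a test
  function of finite energy.
\<close>

lemma sobolev_const_nonneg:
  fixes s :: real
  assumes s: "0 < s" "s < 1" "2 * s < real CARD('n::{finite,wellorder})"
  shows "sobolev_const TYPE('n) s \<ge> 0"
proof -
  let ?q = "crit_exp TYPE('n) s + 1"
  let ?U = "UNIV :: (real^'n::_) set"
  define u where "u = (tent :: real^'n::_ \<Rightarrow> real)"
  have q: "?q > 0" using s by (simp add: crit_exp_def add_pos_pos)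
  have u_meas [measurable]: "u \<in> borel_measurable borel" by (simp add: u_def)
  have u01: "0 \<le> u x" "u x \<le> indicator (ball 0 1) x" for x
    by (auto simp: u_def tent_def split: split_indicator)
  have ball_int: "integrable lborel (indicator (ball (0 :: real^'n::_) 1) :: _ \<Rightarrow> real)"
    using emeasure_lborel_ball_finite[of "0 :: real^'n::_" 1] by (simp add: integrable_indicator_iff)
  have pw: "u x powr ?q \<le> indicator (ball 0 1) x" for x
    using u01[of x] q powr_mono2[of ?q "u x" 1] by (auto split: split_indicator_asm split_indicator)
  have "integrable lborel (\<lambda>x. (u x)\<^sup>2)"
  proof (rule Bochner_Integration.integrable_bound[OF ball_int])
    show "AE x in lborel. norm ((u x)\<^sup>2) \<le> norm (indicator (ball 0 1) x :: real)"
    proof (rule AE_I2)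
      fix x
      show "norm ((u x)\<^sup>2) \<le> norm (indicator (ball 0 1) x :: real)"
        using u01[of x] power_le_one[of "u x" 2] by (auto split: split_indicator_asm split_indicator)
    qed
  qed simp
  moreover have "integrable lborel (gagliardo_kernel s u)"
    unfolding u_def by (rule tent_kernel_integrable) fact+
  ultimately have u_space: "u \<in> frac_space s ?U"
    by (auto simp: frac_space_def set_integrable_def cross_set_def integrable_completion
        measurable_completion gagliardo_kernel_measurable)
  define J where "J = (\<integral>\<^sup>+x. ennreal (u x powr ?q) \<partial>lborel)"
  have "J \<le> (\<integral>\<^sup>+x. indicator (ball 0 1) x \<partial>(lborel :: (real^'n::_) measure))"
    unfolding J_def by (intro nn_integral_mono) (use pw in \<open>auto simp: ennreal_indicator[symmetric] intro!: ennreal_leI\<close>)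
  also have "\<dots> < \<infinity>" using emeasure_lborel_ball_finite[of "0 :: real^'n::_" 1] by simp
  finally have J_fin: "J < \<infinity>" .
  have "J \<noteq> 0"
  proof
    assume "J = 0"
    then have "AE x in lborel. ennreal (u x powr ?q) = 0"
      unfolding J_def by (subst (asm) nn_integral_0_iff_AE) auto
    then have "AE x in lborel. x \<notin> ball (0 :: real^'n::_) 1"
      by (rule AE_mp) (use u01 in \<open>auto intro!: AE_I2 simp: u_def tent_def\<close>)
    then have "ball (0 :: real^'n::_) 1 = {}" by (rule AE_not_in_open_imp_empty) simp
    then show False by simp
  qed
  then have J: "enn2real J > 0" using J_fin by (simp add: enn2real_positive_iff zero_less_iff_neq_zero less_top)
  define L where "L = enn2real J powr (2 / ?q)"
  have L: "L > 0" using J by (simp add: L_def)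
  have Lq: "Lq_norm_sq ?q ?U u = ereal L"
    using J_fin u01 by (simp add: Lq_norm_sq_def Let_def L_def J_def nn_integral_completion)
  let ?S = "{C. \<forall>u \<in> frac_space s ?U. ereal C * Lq_norm_sq ?q ?U u \<le> ereal (frac_energy s ?U u)}"
  have "C \<le> frac_energy s ?U u / L" if "C \<in> ?S" for C
  proof -
    have "ereal C * ereal L \<le> ereal (frac_energy s ?U u)" using that u_space Lq by auto
    then show ?thesis using L by (simp add: pos_le_divide_eq)
  qed
  then have "bdd_above ?S" by (intro bdd_aboveI)
  \<comment> \<open>0 is an admissible constant since the energy is nonnegative; as the set is
    bounded above, its supremum is at least 0.\<close>
  moreover have "frac_energy s ?U w \<ge> 0" for w
    using frac_const_pos[OF s(1,2), where 'n='n] by (intro frac_energy_nonneg less_imp_le)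
  then have "0 \<in> ?S" by (simp add: zero_ereal_def[symmetric])
  ultimately show ?thesis unfolding sobolev_const_def by (intro cSup_upper)
qed

section \<open>Constants as minimizers\<close>

lemma AE_lborel_prod_both:
  fixes P :: "'a::euclidean_space \<Rightarrow> bool"
  assumes "AE x in lborel. P x"
  shows "AE z in (lborel :: ('a \<times> 'a) measure). P (fst z) \<and> P (snd z)"
proof -
  obtain N where N: "{x. \<not> P x} \<subseteq> N" "N \<in> null_sets lborel"
    using assms by (auto elim!: AE_E simp: null_sets_def)
  \<comment> \<open>A pair is exceptional only if one of its entries lies in N. Both strips are
    null, as 0 times \<infinity> is 0 in \<open>ennreal\<close>.\<close>
  have "N \<times> UNIV \<union> UNIV \<times> N \<in> null_sets (lborel \<Otimes>\<^sub>M (lborel :: 'a measure))"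
  proof -
    have "N \<in> sets lborel" "emeasure lborel N = 0" using N(2) by auto
    then show ?thesis
      by (intro null_sets.Un null_setsI) (simp_all add: lborel.emeasure_pair_measure_Times pair_measureI)
  qed
  then show ?thesis
    unfolding lborel_prod by (rule AE_I') (use N(1) in auto)
qed

lemma cross_energy_eq_nn_integral:
  fixes D :: "(real^'n::{finite,wellorder}) set"
  assumes "set_integrable lebesgue (cross_set D) (gagliardo_kernel s u)"
  shows "ennreal (set_lebesgue_integral lebesgue (cross_set D) (gagliardo_kernel s u))
    = (\<integral>\<^sup>+z\<in>cross_set D. ennreal (gagliardo_kernel s u z) \<partial>lborel)"
proof -
  have "(\<integral>\<^sup>+z\<in>cross_set D. ennreal (gagliardo_kernel s u z) \<partial>lborel)
      = (\<integral>\<^sup>+z. ennreal (indicator (cross_set D) z *\<^sub>R gagliardo_kernel s u z) \<partial>lebesgue)"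
    unfolding nn_integral_completion by (intro nn_integral_cong) (auto split: split_indicator)
  also have "\<dots> = ennreal (set_lebesgue_integral lebesgue (cross_set D) (gagliardo_kernel s u))"
    unfolding set_lebesgue_integral_def using assms
    by (intro nn_integral_eq_integral) (auto simp: set_integrable_def gagliardo_kernel_nonneg)
  finally show ?thesis by simp
qed

text \<open>D \<times> D is part of \<open>cross_set D\<close> and the kernel is nonnegative.
  Tonelli's theorem is applied to the Borel representative u', whose kernel agrees with that of u
  almost everywhere.\<close>

lemma density_le_cross_energy:
  fixes D :: "(real^'n::{finite,wellorder}) set"
  assumes [measurable]: "D \<in> sets borel" "u' \<in> borel_measurable borel"
    and u: "AE x in lborel. u x = u' x"
    and int: "set_integrable lebesgue (cross_set D) (gagliardo_kernel s u)"
  shows "(\<integral>\<^sup>+x\<in>D. nonlocal_density s D u' x \<partial>lborel)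
    \<le> ennreal (set_lebesgue_integral lebesgue (cross_set D) (gagliardo_kernel s u))"
proof -
  let ?k = "\<lambda>x y. ennreal (gagliardo_kernel s u' (x, y)) * indicator D y * indicator D x"
  have [measurable]: "gagliardo_kernel s u' \<in> borel_measurable (lborel \<Otimes>\<^sub>M lborel)"
    using gagliardo_kernel_measurable[of u' s] by (simp add: lborel_prod)
  have meas: "(\<lambda>(x, y). ?k x y) \<in> borel_measurable (lborel \<Otimes>\<^sub>M lborel)" by measurable
  have "(\<integral>\<^sup>+x\<in>D. nonlocal_density s D u' x \<partial>lborel) = (\<integral>\<^sup>+x. \<integral>\<^sup>+y. ?k x y \<partial>lborel \<partial>lborel)"
  proof (intro nn_integral_cong)
    fix x
    have "nonlocal_density s D u' x = (\<integral>\<^sup>+y. ennreal (gagliardo_kernel s u' (x, y)) * indicator D y \<partial>lborel)"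
      by (simp add: nonlocal_density_def gagliardo_kernel_def)
    moreover have "(\<lambda>y. ennreal (gagliardo_kernel s u' (x, y)) * indicator D y) \<in> borel_measurable lborel"
      by measurable
    ultimately show "nonlocal_density s D u' x * indicator D x = (\<integral>\<^sup>+y. ?k x y \<partial>lborel)"
      by (simp add: nn_integral_multc)
  qed
  also have "\<dots> = (\<integral>\<^sup>+z. (case z of (x, y) \<Rightarrow> ?k x y) \<partial>lborel)"
    using lborel.nn_integral_fst[OF meas] by (simp add: lborel_prod)
  also have "\<dots> \<le> (\<integral>\<^sup>+z\<in>cross_set D. ennreal (gagliardo_kernel s u z) \<partial>lborel)"
  proof (rule nn_integral_mono_AE)
    show "AE z in lborel. (case z of (x, y) \<Rightarrow> ?k x y) \<le> ennreal (gagliardo_kernel s u z) * indicator (cross_set D) z"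
      using AE_lborel_prod_both[OF u]
    proof eventually_elim
      case (elim z)
      then show ?case
        by (cases z) (auto simp: gagliardo_kernel_def cross_set_def split: split_indicator)
    qed
  qed
  also have "\<dots> = ennreal (set_lebesgue_integral lebesgue (cross_set D) (gagliardo_kernel s u))"
    using cross_energy_eq_nn_integral[OF int] by simp
  finally show ?thesis .
qed

text \<open>\<open>cross_set D\<close> contains D times the whole space, so for almost every x in D
  the function equals u x almost everywhere. As D has positive measure, such an x exists, and its
  value is the constant.\<close>

lemma cross_energy_zero_imp_const:
  fixes D :: "(real^'n::{finite,wellorder}) set"
  assumes D: "open D" "D \<noteq> {}"
    and int: "set_integrable lebesgue (cross_set D) (gagliardo_kernel s u)"
    and zero: "set_lebesgue_integral lebesgue (cross_set D) (gagliardo_kernel s u) = 0"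
  obtains c where "AE x in lebesgue. u x = c"
proof -
  have "AE z in lebesgue. indicator (cross_set D) z *\<^sub>R gagliardo_kernel s u z = 0"
    using zero int unfolding set_lebesgue_integral_def set_integrable_def
    by (subst (asm) integral_nonneg_eq_0_iff_AE) (auto simp: gagliardo_kernel_nonneg)
  then have "AE z in lborel \<Otimes>\<^sub>M lborel. indicator (cross_set D) z *\<^sub>R gagliardo_kernel s u z = 0"
    by (simp only: AE_completion_iff lborel_prod)
  then have "AE x in lborel. AE y in lborel. indicator (cross_set D) (x, y) *\<^sub>R gagliardo_kernel s u (x, y) = 0"
    by (rule lborel_pair.AE_pair)
  then have *: "AE x in lborel. x \<in> D \<longrightarrow> (AE y in lborel. u y = u x)"
  proof eventually_elim
    case (elim x)
    show ?case
    proof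
      assume x: "x \<in> D"
      show "AE y in lborel. u y = u x"
        using elim
      proof eventually_elim
        case (elim y)
        have "(x, y) \<in> cross_set D" using x by (simp add: cross_set_def)
        then show ?case using elim by (auto simp: gagliardo_kernel_def)
      qed
    qed
  qed
  have "\<exists>x\<in>D. AE y in lborel. u y = u x"
  proof (rule ccontr)
    assume "\<not> (\<exists>x\<in>D. AE y in lborel. u y = u x)"
    then have "AE x in lborel. x \<notin> D" using * by auto
    then show False using AE_not_in_open_imp_empty D by blast
  qed
  then show thesis using that by (auto simp: AE_completion_iff)
qed

text \<open>Carries the inequality of the locale over to the notions of the problem: from Borel to
  Lebesgue measurable functions, and from the seminorm over D \<times> D to the integral over
  \<open>cross_set D\<close>. The form \<open>ereal J\<close> records that the norm is
  finite.\<close>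

lemma Lq_norm_sq_le:
  fixes D :: "(real^'n::{finite,wellorder}) set"
  assumes "fat_domain D \<kappa> \<rho> s (real CARD('n)) q"
    and u: "u \<in> frac_space s D"
    and C1: "C1 > 0" "\<And>m h. \<bar>m + h\<bar> powr q \<le>
      \<bar>m\<bar> powr q + q * \<bar>m\<bar> powr (q - 2) * m * h + C1 * (\<bar>m\<bar> powr (q - 2) * h\<^sup>2 + \<bar>h\<bar> powr q)"
  obtains J where "Lq_norm_sq q D u = ereal J" "J \<ge> 0"
    "J \<le> measure lebesgue D powr (- 2 * s / real CARD('n)) * set_lebesgue_integral lebesgue D (\<lambda>x. (u x)\<^sup>2)
      + fat_domain.sob_const \<kappa> s (real CARD('n)) q C1
        * set_lebesgue_integral lebesgue (cross_set D) (gagliardo_kernel s u)"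
proof -
  interpret fat_domain D \<kappa> \<rho> s "real CARD('n)" q by fact
  have u_meas: "u \<in> borel_measurable lebesgue" and u2: "set_integrable lebesgue D (\<lambda>x. (u x)\<^sup>2)"
    and uk: "set_integrable lebesgue (cross_set D) (gagliardo_kernel s u)"
    using u by (auto simp: frac_space_def)
  obtain u' where u'_meas [measurable]: "u' \<in> borel_measurable borel" and u': "AE x in lborel. u x = u' x"
    using completion_ex_borel_measurable_real[OF u_meas] by auto
  define I where "I = set_lebesgue_integral lebesgue (cross_set D) (gagliardo_kernel s u)"
  have I0: "I \<ge> 0" unfolding I_def set_lebesgue_integral_def
    by (intro Bochner_Integration.integral_nonneg) (simp add: gagliardo_kernel_nonneg)
  have u'_AE: "AE x in lebesgue. u x = u' x" using u' by (simp add: AE_completion_iff)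
  have "integrable lebesgue (\<lambda>x. indicator D x *\<^sub>R (u' x)\<^sup>2)"
    using u2 unfolding set_integrable_def
    by (rule integrable_cong_AE_imp) (use u'_AE in \<open>auto simp: measurable_completion\<close>)
  then have u'2: "set_integrable lborel D (\<lambda>x. (u' x)\<^sup>2)"
    unfolding set_integrable_def by (subst (asm) integrable_completion) measurable
  have L2: "(LINT x:D|lborel. (u' x)\<^sup>2) = set_lebesgue_integral lebesgue D (\<lambda>x. (u x)\<^sup>2)"
  proof -
    have "set_lebesgue_integral lebesgue D (\<lambda>x. (u x)\<^sup>2) = (LINT x:D|lebesgue. (u' x)\<^sup>2)"
      unfolding set_lebesgue_integral_def
      using u2 u'_AE by (intro integral_cong_AE) (auto simp: set_integrable_def measurable_completion)
    also have "\<dots> = (LINT x:D|lborel. (u' x)\<^sup>2)"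
      unfolding set_lebesgue_integral_def by (rule integral_completion) measurable
    finally show ?thesis by simp
  qed
  define G where "G = (\<integral>\<^sup>+x\<in>D. nonlocal_density s D u' x \<partial>lborel)"
  have G: "G \<le> ennreal I" unfolding G_def I_def by (rule density_le_cross_energy[OF D(1) u'_meas u' uk])
  then have G_fin: "G < \<infinity>" by (auto simp: less_top[symmetric] top_unique)
  have G_le: "enn2real G \<le> I" using G I0 by (simp add: enn2real_leI)
  define Q where "Q = (\<integral>\<^sup>+x\<in>D. ennreal (\<bar>u x\<bar> powr q) \<partial>lebesgue)"
  have Q_eq: "Q = (\<integral>\<^sup>+x\<in>D. ennreal (\<bar>u' x\<bar> powr q) \<partial>lborel)"
    unfolding Q_def nn_integral_completion using u' by (intro nn_integral_cong_AE) auto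
  define R where "R = V powr (- 2 * s / real CARD('n)) * (LINT x:D|lborel. (u' x)\<^sup>2) + sob_const C1 * enn2real G"
  have Q_le: "Q \<le> ennreal (R powr (q / 2))"
    unfolding Q_eq R_def G_def
    by (rule sobolev_inequality[OF u'_meas u'2 G_fin[unfolded G_def] C1])
  then have Q_fin: "Q \<noteq> \<infinity>" by (auto simp: top_unique)
  have "(LINT x:D|lborel. (u' x)\<^sup>2) \<ge> 0"
    unfolding set_lebesgue_integral_def by (intro Bochner_Integration.integral_nonneg) simp
  then have R0: "R \<ge> 0" using sob_const_nonneg[OF C1(1)] by (simp add: R_def)
  have "enn2real Q powr (2 / q) \<le> (R powr (q / 2)) powr (2 / q)"
    using Q_le q_gt_2 by (intro powr_mono2 enn2real_leI) auto
  also have "\<dots> = R" using R0 q_gt_2 by (simp add: powr_powr)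
  also have "R \<le> V powr (- 2 * s / real CARD('n)) * (LINT x:D|lborel. (u' x)\<^sup>2) + sob_const C1 * I"
    unfolding R_def using G_le sob_const_nonneg[OF C1(1)] by (intro add_left_mono mult_left_mono)
  finally have "enn2real Q powr (2 / q) \<le> \<dots>" .
  moreover have "measure lebesgue D = V" using D(1) by simp
  moreover have "Lq_norm_sq q D u = ereal (enn2real Q powr (2 / q))"
    using Q_fin by (simp add: Lq_norm_sq_def Let_def Q_def)
  ultimately show thesis using that[of "enn2real Q powr (2 / q)"] by (simp add: L2 I_def)
qed

lemma const_in_frac_space:
  fixes D :: "(real^'n::{finite,wellorder}) set"
  assumes "D \<in> sets borel" "emeasure lborel D < \<infinity>"
  shows "(\<lambda>x. 1) \<in> frac_space s D"
proof -
  have "set_integrable lebesgue D (\<lambda>x. 1 :: real)"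
    using assms by (simp add: set_integrable_def integrable_completion)
  moreover have "gagliardo_kernel s (\<lambda>x :: real^'n::_. 1) = (\<lambda>z. 0)"
    by (auto simp: gagliardo_kernel_def)
  ultimately show ?thesis by (simp add: frac_space_def set_integrable_def)
qed

text \<open>All geometry of D is condensed in the hypothesis \<open>Lq\<close>; what remains is
  algebra with the energy integral E, the L2 term and J.\<close>

lemma constants_minimize:
  fixes D :: "(real^'n::{finite,wellorder}) set" and s lam K :: real
  defines "V \<equiv> measure lebesgue D" and "q \<equiv> crit_exp TYPE('n) s + 1"
  assumes s: "0 < s" "2 * s < real CARD('n)"
    and D: "open D" "D \<noteq> {}" "emeasure lborel D < \<infinity>"
    and lam: "lam > 0" and K: "K \<ge> 0"
    and Lq: "\<And>u. u \<in> frac_space s D \<Longrightarrow> \<exists>J\<ge>0. Lq_norm_sq q D u = ereal J \<and>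
      J \<le> V powr (- 2 * s / real CARD('n)) * set_lebesgue_integral lebesgue D (\<lambda>x. (u x)\<^sup>2)
        + K * set_lebesgue_integral lebesgue (cross_set D) (gagliardo_kernel s u)"
    and small: "lam * V powr (2 * s / real CARD('n)) * K < frac_const TYPE('n) s / 2"
  shows "is_minimizer s lam D (\<lambda>x. 1)"
    and "is_minimizer s lam D w \<Longrightarrow> \<exists>c. c \<noteq> 0 \<and> (AE x in lebesgue. w x = c)"
proof -
  let ?n = "real CARD('n)"
  define E where "E u = set_lebesgue_integral lebesgue (cross_set D) (gagliardo_kernel s u)" for u :: "real^'n::_ \<Rightarrow> real"
  define L2 where "L2 u = set_lebesgue_integral lebesgue D (\<lambda>x. (u x)\<^sup>2)" for u :: "real^'n::_ \<Rightarrow> real"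
  define \<theta> where "\<theta> = V powr (2 * s / ?n)"
  define c where "c = frac_const TYPE('n) s / 2"
  have D_sets: "D \<in> sets borel" using D(1) by simp
  have emV: "emeasure lborel D = ennreal V"
    using D(3) D_sets by (simp add: V_def emeasure_eq_ennreal_measure less_top)
  have V: "V > 0"
  proof -
    have "emeasure lborel D \<noteq> 0"
    proof
      assume "emeasure lborel D = 0"
      then have "D \<in> null_sets lborel" using D_sets by auto
      then have "AE x in lborel. x \<notin> D" by (rule AE_not_in)
      then show False using AE_not_in_open_imp_empty D by blast
    qed
    then show ?thesis using emV by (simp add: zero_less_measure_iff V_def measure_nonneg order_le_less)
  qed
  have \<theta>: "\<theta> > 0" using V by (simp add: \<theta>_def)
  have \<theta>': "V powr (- 2 * s / ?n) = 1 / \<theta>"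
    using powr_minus_divide[of V "2 * s / ?n"] by (simp add: \<theta>_def)
  have c: "lam * \<theta> * K < c" using small by (simp add: \<theta>_def c_def)
  have "lam * \<theta> * K \<ge> 0" using lam \<theta> K by simp
  with c have c0: "c > 0" by linarith
  have E0: "E u \<ge> 0" for u unfolding E_def set_lebesgue_integral_def
    by (intro Bochner_Integration.integral_nonneg) (simp add: gagliardo_kernel_nonneg)
  have L20: "L2 u \<ge> 0" for u unfolding L2_def set_lebesgue_integral_def
    by (intro Bochner_Integration.integral_nonneg) simp
  define num where "num u = c * E u + lam * L2 u" for u
  have ray: "rayleigh s lam D u = ereal (num u) / Lq_norm_sq q D u" for u
    by (simp add: rayleigh_def frac_energy_def num_def c_def E_def L2_def q_def)
  have E_zero_const: "\<exists>b. b \<noteq> 0 \<and> (AE x in lebesgue. u x = b)"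
    if u: "u \<in> frac_space_nonzero s D" and E: "E u = 0" for u
  proof -
    have "set_integrable lebesgue (cross_set D) (gagliardo_kernel s u)"
      using u by (simp add: frac_space_nonzero_def frac_space_def)
    then obtain b where b: "AE x in lebesgue. u x = b"
      using E unfolding E_def by (rule cross_energy_zero_imp_const[OF D(1,2)])
    moreover have "b \<noteq> 0" using b u by (auto simp: frac_space_nonzero_def)
    ultimately show ?thesis by blast
  qed
  have L2_const: "L2 u = b\<^sup>2 * V" if "AE x in lebesgue. u x = b" "u \<in> borel_measurable lebesgue" for u b
  proof -
    have "L2 u = set_lebesgue_integral lebesgue D (\<lambda>x. b\<^sup>2)"
      unfolding L2_def set_lebesgue_integral_def
    proof (rule integral_cong_AE)
      have [measurable]: "D \<in> sets lebesgue" "u \<in> borel_measurable lebesgue" using D_sets that by auto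
      show "(\<lambda>x. indicator D x *\<^sub>R (u x)\<^sup>2) \<in> borel_measurable lebesgue"
        "(\<lambda>x. indicator D x *\<^sub>R b\<^sup>2) \<in> borel_measurable lebesgue" by measurable
    qed (use that in auto)
    also have "\<dots> = b\<^sup>2 * V"
      using D_sets D(3) emV by (simp add: set_lebesgue_integral_def integral_completion V_def)
    finally show ?thesis .
  qed
  have key: "ereal (lam * \<theta>) \<le> rayleigh s lam D u \<and> (rayleigh s lam D u = ereal (lam * \<theta>) \<longrightarrow> E u = 0)"
    if u: "u \<in> frac_space_nonzero s D" for u
  proof -
    have u': "u \<in> frac_space s D" using u by (simp add: frac_space_nonzero_def)
    obtain J where J: "J \<ge> 0" "Lq_norm_sq q D u = ereal J" "J \<le> 1 / \<theta> * L2 u + K * E u"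
      using Lq[OF u'] unfolding \<theta>' E_def L2_def by blast
    \<comment> \<open>Multiplication by \<lambda> \<theta> reproduces exactly the L2 term of the
      numerator. The strict bound on K leaves a positive multiple of E u to spare, which forces E u
      = 0 in the case of equality.\<close>
    have "lam * \<theta> * J \<le> lam * \<theta> * (1 / \<theta> * L2 u + K * E u)"
      using lam \<theta> J(3) by (intro mult_left_mono) auto
    also have "\<dots> = lam * L2 u + lam * \<theta> * K * E u" using \<theta> by (simp add: field_simps)
    finally have num_ge: "lam * \<theta> * J + (c - lam * \<theta> * K) * E u \<le> num u"
      by (simp add: num_def algebra_simps)
    have gap: "(c - lam * \<theta> * K) * E u \<ge> 0" using c E0[of u] by simp
    show ?thesis
    proof (cases "J = 0")
      case True
      \<comment> \<open>For J = 0 the quotient is \<infinity> in \<open>ereal\<close> if the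
        numerator is positive, but 0 if it vanishes. The latter would make u a nonzero constant with
        zero L2 norm on D, impossible as V > 0.\<close>
      have "num u > 0"
      proof (rule ccontr)
        assume "\<not> num u > 0"
        moreover have "c * E u \<ge> 0" "lam * L2 u \<ge> 0" using c0 lam E0 L20 by auto
        ultimately have "c * E u = 0" "lam * L2 u = 0" unfolding num_def by linarith+
        then have z: "E u = 0" "L2 u = 0" using c0 lam by auto
        obtain b where b: "b \<noteq> 0" "AE x in lebesgue. u x = b" using E_zero_const[OF u z(1)] by blast
        have "L2 u = b\<^sup>2 * V" using b(2) u' by (intro L2_const) (auto simp: frac_space_def)
        then show False using z b V by simp
      qed
      then show ?thesis using True J(2) by (simp add: ray)
    next
      case False
      then have J0: "J > 0" using J(1) by simp
      then have r: "rayleigh s lam D u = ereal (num u / J)" using J(2) by (simp add: ray)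
      have "lam * \<theta> \<le> num u / J" using J0 num_ge gap by (simp add: pos_le_divide_eq)
      moreover have "E u = 0" if "num u / J = lam * \<theta>"
      proof -
        have "num u = lam * \<theta> * J" using that J0 by (simp add: divide_eq_eq)
        then have "(c - lam * \<theta> * K) * E u \<le> 0" using num_ge by simp
        then show ?thesis using c E0[of u] by (simp add: mult_le_0_iff)
      qed
      ultimately show ?thesis by (simp add: r)
    qed
  qed
  have one: "(\<lambda>x. 1) \<in> frac_space_nonzero s D"
  proof -
    have "\<not> (AE x in (lebesgue :: (real^'n::_) measure). (1::real) = 0)"
      using AE_not_in_open_imp_empty[of UNIV] by (auto simp: AE_completion_iff)
    then show ?thesis using const_in_frac_space[OF D_sets D(3)] by (simp add: frac_space_nonzero_def)
  qed
  have q: "2 / q = 1 - 2 * s / ?n" using s by (simp add: q_def crit_exp_def field_simps)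
  have ray_one: "rayleigh s lam D (\<lambda>x. 1) = ereal (lam * \<theta>)"
  proof -
    have "E (\<lambda>x. 1) = 0" by (simp add: E_def gagliardo_kernel_def set_lebesgue_integral_def case_prod_unfold)
    moreover have "L2 (\<lambda>x. 1) = V" using L2_const[of "\<lambda>x. 1" 1] by simp
    ultimately have num1: "num (\<lambda>x. 1) = lam * V" by (simp add: num_def)
    have "(\<integral>\<^sup>+x\<in>D. ennreal (\<bar>1::real\<bar> powr q) \<partial>lebesgue) = ennreal V"
      using emV D_sets by (simp add: nn_integral_completion)
    then have "Lq_norm_sq q D (\<lambda>x. 1) = ereal (V powr (2 / q))"
      using V by (simp add: Lq_norm_sq_def Let_def)
    then have "rayleigh s lam D (\<lambda>x. 1) = ereal (lam * V / V powr (2 / q))"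
      using V by (simp add: ray num1)
    \<comment> \<open>The exponent is 1 - 2/q = 2s/n, so constants attain the lower bound.\<close>
    also have "V / V powr (2 / q) = \<theta>"
      using V unfolding q by (simp add: powr_diff \<theta>_def)
    then have "lam * V / V powr (2 / q) = lam * \<theta>" by (simp flip: times_divide_eq_right)
    finally show ?thesis .
  qed
  have X: "X_inf s lam D = ereal (lam * \<theta>)"
    unfolding X_inf_def using one ray_one key by (intro INF_eqI) (auto, metis)
  show "is_minimizer s lam D (\<lambda>x. 1)"
    using one by (simp add: is_minimizer_def X ray_one)
  show "\<exists>c. c \<noteq> 0 \<and> (AE x in lebesgue. w x = c)" if "is_minimizer s lam D w"
    using that key[of w] E_zero_const[of w] by (auto simp: is_minimizer_def X)
qed

theorem theorem1p4:
  fixes s lam :: real and \<Omega> :: "(real^'n::{finite,wellorder}) set"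
  assumes "0 < s" and "s < 1"
    and "real CARD('n) > max (4 * s) ((8 * s + 2) / 3)"
    and "bounded_C1_domain \<Omega>"
    and "lam > lambda_star s \<Omega>"
  shows "\<exists>\<delta>>0. \<forall>\<eta>. 0 < \<eta> \<and> \<eta> < \<delta> \<longrightarrow>
           (\<exists>v. is_minimizer s lam ((\<lambda>x. \<eta> *\<^sub>R x) ` \<Omega>) v \<and>
                (\<forall>w. is_minimizer s lam ((\<lambda>x. \<eta> *\<^sub>R x) ` \<Omega>) w \<longrightarrow>
                     (\<exists>c. c \<noteq> 0 \<and> (AE x in lebesgue. w x = c * v x))))"
proof -
  let ?n = "real CARD('n)" and ?q = "crit_exp TYPE('n) s + 1"
  have s: "0 < s" "s < 1" "2 * s < ?n" using assms by auto
  have q: "?q = 2 * ?n / (?n - 2 * s)" using s by (simp add: crit_exp_def field_simps)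
  have q2: "?q > 2" using s unfolding q by (simp add: field_simps)
  \<comment> \<open>Positivity of \<lambda> comes from here: it exceeds \<open>lambda_star\<close>,
    which is nonnegative because S is.\<close>
  have "lambda_star s \<Omega> \<ge> 0" using sobolev_const_nonneg[OF s] by (simp add: lambda_star_def)
  then have lam: "lam > 0" using assms(5) by simp
  obtain a \<rho> where a: "a > 0" "\<rho> > 0" "corkscrew a \<rho> \<Omega>" "\<And>x. x \<in> \<Omega> \<Longrightarrow> \<Omega> \<subseteq> ball x \<rho>"
    using bounded_C1_domain_corkscrew[OF assms(4)] by blast
  have \<Omega>: "open \<Omega>" "\<Omega> \<noteq> {}" using assms(4) by (auto simp: bounded_C1_domain_def)
  \<comment> \<open>The density constant of \<open>corkscrew_measure_ge\<close>. It is fixed before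
    \<eta>, and so are C1 and K.\<close>
  define \<kappa> where "\<kappa> = unit_ball_vol ?n * a ^ CARD('n)"
  have \<kappa>: "\<kappa> > 0" using a by (simp add: \<kappa>_def)
  obtain C1 where C1: "C1 > 0" "\<And>m h. \<bar>m + h\<bar> powr ?q \<le>
      \<bar>m\<bar> powr ?q + ?q * \<bar>m\<bar> powr (?q - 2) * m * h + C1 * (\<bar>m\<bar> powr (?q - 2) * h\<^sup>2 + \<bar>h\<bar> powr ?q)"
    using powr_second_order[OF q2] by blast
  define K where "K = fat_domain.sob_const \<kappa> s ?n ?q C1"
  have fat: "fat_domain ((\<lambda>x. \<eta> *\<^sub>R x) ` \<Omega>) \<kappa> (\<eta> * \<rho>) s ?n ?q" if \<eta>: "\<eta> > 0" for \<eta>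
  proof
    let ?D = "(\<lambda>x. \<eta> *\<^sub>R x) ` \<Omega>"
    have op: "open ?D" using \<Omega>(1) \<eta> by (intro open_scaling) auto
    show "?D \<in> sets borel" "?D \<noteq> {}" using op \<Omega> by auto
    show "\<kappa> * t ^ DIM(real^'n::_) \<le> measure lborel (?D \<inter> ball x t)" if "x \<in> ?D" "0 < t" "t \<le> \<eta> * \<rho>" for x t
      using corkscrew_measure_ge[OF corkscrew_scale[OF a(3) \<eta>] a(1) _ that] op
      by (simp add: \<kappa>_def)
    show "?D \<subseteq> ball x (\<eta> * \<rho>)" if x: "x \<in> ?D" for x
    proof -
      obtain y where y: "y \<in> \<Omega>" "x = \<eta> *\<^sub>R y" using x by blast
      have "?D \<subseteq> (\<lambda>x. \<eta> *\<^sub>R x) ` ball y \<rho>" using a(4)[OF y(1)] by (rule image_mono)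
      also have "\<dots> = ball x (\<eta> * \<rho>)" using \<eta> y by (simp add: ball_scale)
      finally show ?thesis .
    qed
  qed (use s q \<kappa> a that in auto)
  \<comment> \<open>Any dilate serves here, as \<open>sob_const\<close> refers neither to the set
    nor to its length scale.\<close>
  have K: "K \<ge> 0" unfolding K_def by (rule fat_domain.sob_const_nonneg[OF fat[of 1] C1(1)]) simp
  \<comment> \<open>The dilate lies in a ball of radius \<eta> \<rho>, so its measure to the power
    2s/n is at most M \<eta>^(2s).\<close>
  define M where "M = (unit_ball_vol ?n * \<rho> powr ?n) powr (2 * s / ?n)"
  define c where "c = frac_const TYPE('n) s / 2"
  have c: "c > 0" using frac_const_pos[OF s(1,2), where 'n='n] by (simp add: c_def)
  \<comment> \<open>The summand 1 makes N positive even if K vanishes, so that \<delta>, the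
    solution of N \<delta>^(2s) = c, exists.\<close>
  define N where "N = lam * M * K + 1"
  have N: "N > 0" using lam K by (simp add: N_def M_def add_nonneg_pos)
  define \<delta> where "\<delta> = (c / N) powr (1 / (2 * s))"
  have \<delta>: "\<delta> > 0" using c N by (simp add: \<delta>_def)
  show ?thesis
  proof (intro exI[of _ \<delta>] conjI allI impI \<delta>)
    fix \<eta> assume "0 < \<eta> \<and> \<eta> < \<delta>"
    then have \<eta>: "0 < \<eta>" "\<eta> < \<delta>" by auto
    define D where "D = (\<lambda>x. \<eta> *\<^sub>R x) ` \<Omega>"
    interpret fat_domain D \<kappa> "\<eta> * \<rho>" s ?n ?q unfolding D_def by (rule fat[OF \<eta>(1)])
    have D_open: "open D" unfolding D_def using \<Omega>(1) \<eta> by (intro open_scaling) auto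
    have V: "measure lebesgue D \<le> unit_ball_vol ?n * \<rho> powr ?n * \<eta> powr ?n"
    proof -
      obtain x where x: "x \<in> D" using D(2) by blast
      have "measure lebesgue D \<le> measure lebesgue (ball x (\<eta> * \<rho>))"
        using small[OF x] D_open by (intro measure_mono_fmeasurable) auto
      also have "\<dots> = unit_ball_vol ?n * (\<eta> * \<rho>) ^ CARD('n)"
        using content_ball[of "\<eta> * \<rho>" x] a(2) \<eta> by simp
      also have "(\<eta> * \<rho>) ^ CARD('n) = \<eta> powr ?n * \<rho> powr ?n"
        using a(2) \<eta> by (simp add: powr_realpow power_mult_distrib)
      finally show ?thesis by (simp add: mult_ac)
    qed
    have "measure lebesgue D powr (2 * s / ?n) \<le> (unit_ball_vol ?n * \<rho> powr ?n * \<eta> powr ?n) powr (2 * s / ?n)"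
      using V s by (intro powr_mono2) auto
    also have "\<dots> = M * \<eta> powr (2 * s)" by (simp add: M_def powr_mult powr_powr)
    finally have V': "measure lebesgue D powr (2 * s / ?n) \<le> M * \<eta> powr (2 * s)" .
    have "\<eta> powr (2 * s) < \<delta> powr (2 * s)" using \<eta> s by (intro powr_less_mono2) auto
    also have "\<delta> powr (2 * s) = c / N" using c N s by (simp add: \<delta>_def powr_powr)
    finally have "N * \<eta> powr (2 * s) < c" using N by (simp add: pos_less_divide_eq mult.commute)
    moreover have "lam * K * measure lebesgue D powr (2 * s / ?n) \<le> lam * K * (M * \<eta> powr (2 * s))"
      using V' lam K by (intro mult_left_mono) auto
    moreover have "N * \<eta> powr (2 * s) = lam * K * (M * \<eta> powr (2 * s)) + \<eta> powr (2 * s)"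
      by (simp add: N_def algebra_simps)
    ultimately have "lam * K * measure lebesgue D powr (2 * s / ?n) < c"
      using powr_ge_zero[of \<eta> "2 * s"] by linarith
    then have small_D: "lam * measure lebesgue D powr (2 * s / ?n) * K < frac_const TYPE('n) s / 2"
      unfolding c_def by (simp only: mult_ac)
    have Lq: "\<exists>J\<ge>0. Lq_norm_sq ?q D u = ereal J \<and>
        J \<le> measure lebesgue D powr (- 2 * s / ?n) * set_lebesgue_integral lebesgue D (\<lambda>x. (u x)\<^sup>2)
        + K * set_lebesgue_integral lebesgue (cross_set D) (gagliardo_kernel s u)"
      if "u \<in> frac_space s D" for u
      using Lq_norm_sq_le[OF fat_domain_axioms that C1] unfolding K_def by metis
    note min = constants_minimize[OF s(1,2) D_open D(2) finite_emeasure[OF order_refl] lam K Lq small_D]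
    show "\<exists>v. is_minimizer s lam ((\<lambda>x. \<eta> *\<^sub>R x) ` \<Omega>) v \<and>
                (\<forall>w. is_minimizer s lam ((\<lambda>x. \<eta> *\<^sub>R x) ` \<Omega>) w \<longrightarrow>
                     (\<exists>c. c \<noteq> 0 \<and> (AE x in lebesgue. w x = c * v x)))"
      unfolding D_def[symmetric] using min by (intro exI[of _ "\<lambda>x. 1"]) auto
  qed
qed

end
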